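(* For $l\in\{-\infty,0,1,2,\dots,\infty\}$, let $a_l$ denote the Aufhebung of the level labelled by $l$ in the topos $\mathbf{PSh}(\mathbf F)$ of symmetric sets, i.e. the least $a_l\in\{-\infty,0,1,2,\dots,\infty\}$ with $l\le a_l$ such that every $l$-skeletal symmetric set is $a_l$-coskeletal. Then \[ a_l=\begin{cases}0 & (l=-\infty)\\ 1 & (l=0)\\ 2 & (l=1)\\ 4 & (l=2)\\ 2l-1 & (3\le l<\infty)\\ \infty & (l=\infty).\end{cases} \]
   Context: $\mathbf F$ is the category of non-empty finite sets and all functions. A symmetric set is a functor $M\colon\mathbf F^{\mathrm{op}}\to\mathbf{Set}$, and $\mathbf{PSh}(\mathbf F)=[\mathbf F^{\mathrm{op}},\mathbf{Set}]$. For an integer $l\ge 0$, $\mathbf F_l\subset\mathbf F$ is the full subcategory of sets of size at most $l+1$; $\mathbf F_{-\infty}$ is the empty category and $\mathbf F_\infty=\mathbf F$. Let $\iota_l\colon\mathbf F_l\to\mathbf F$ be the inclusion, with restriction functor $\iota_l^*\colon\mathbf{PSh}(\mathbf F)\to\mathbf{PSh}(\mathbf F_l)$ and its left and right adjoints $\mathrm{Lan}_{\iota_l}$, $\mathrm{Ran}_{\iota_l}$. The level labelled by $l$ is the adjoint triple $\mathrm{Lan}_{\iota_l}\dashv\iota_l^*\dashv\mathrm{Ran}_{\iota_l}$. Put $\mathrm{sk}_l=\mathrm{Lan}_{\iota_l}\iota_l^*$ (a comonad) and $\mathrm{cosk}_l=\mathrm{Ran}_{\iota_l}\iota_l^*$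 (a monad). A symmetric set $M$ is $l$-skeletal if the counit $\mathrm{sk}_lM\to M$ is invertible, and $l$-coskeletal if the unit $M\to\mathrm{cosk}_lM$ is invertible. The labels are ordered by $-\infty<0<1<2<\dots<\infty$. *)

theory Defs
  imports "HOL-Library.FuncSet" "HOL-Library.Extended"
begin

text \<open>
  Levels are labelled by \<^typ>\<open>nat extended\<close>, whose order is
  \<^term>\<open>Minf\<close> < \<^term>\<open>Fin 0\<close> < \<^term>\<open>Fin 1\<close> < ... < \<^term>\<open>Pinf\<close>.
  The category F is realised with the non-empty finite sets of natural numbers as objects and
  the extensional functions \<open>A \<rightarrow>\<^sub>E B\<close> as morphisms from \<open>A\<close> to \<open>B\<close>; it contains a set of every
  finite positive size. The full subcategories \<open>F_obs l\<close> are given by their sets of objects.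
\<close>

definition F_obs :: "nat extended \<Rightarrow> nat set set" where
  "F_obs l = {A. finite A \<and> A \<noteq> {} \<and>
     (case l of Minf \<Rightarrow> False | Fin n \<Rightarrow> card A \<le> n + 1 | Pinf \<Rightarrow> True)}"

text \<open>
  For \<open>f \<in> A \<rightarrow>\<^sub>E B\<close> the map \<open>act M A B f\<close> goes from \<open>el M B\<close> to \<open>el M A\<close>.
  Values outside the relevant objects, morphisms and elements are irrelevant.
\<close>

record 'a psh =
  el :: "nat set \<Rightarrow> 'a set"
  act :: "nat set \<Rightarrow> nat set \<Rightarrow> (nat \<Rightarrow> nat) \<Rightarrow> 'a \<Rightarrow> 'a"

definition presheaf :: "nat set set \<Rightarrow> 'a psh \<Rightarrow> bool" where
  "presheaf C M \<longleftrightarrow>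
     (\<forall>A\<in>C. \<forall>B\<in>C. \<forall>f\<in>A \<rightarrow>\<^sub>E B. \<forall>x\<in>el M B. act M A B f x \<in> el M A) \<and>
     (\<forall>A\<in>C. \<forall>x\<in>el M A. act M A A (\<lambda>a\<in>A. a) x = x) \<and>
     (\<forall>A\<in>C. \<forall>B\<in>C. \<forall>D\<in>C. \<forall>f\<in>A \<rightarrow>\<^sub>E B. \<forall>g\<in>B \<rightarrow>\<^sub>E D. \<forall>x\<in>el M D.
        act M A D (compose A g f) x = act M A B f (act M B D g x))"

definition natural ::
    "nat set set \<Rightarrow> 'a psh \<Rightarrow> 'b psh \<Rightarrow> (nat set \<Rightarrow> 'a \<Rightarrow> 'b) \<Rightarrow> bool" where
  "natural C M N t \<longleftrightarrow>
     (\<forall>A\<in>C. \<forall>x\<in>el M A. t A x \<in> el N A) \<and>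
     (\<forall>A\<in>C. \<forall>B\<in>C. \<forall>f\<in>A \<rightarrow>\<^sub>E B. \<forall>x\<in>el M B. t A (act M A B f x) = act N A B f (t B x))"

definition invertible ::
    "nat set set \<Rightarrow> 'a psh \<Rightarrow> 'b psh \<Rightarrow> (nat set \<Rightarrow> 'a \<Rightarrow> 'b) \<Rightarrow> bool" where
  "invertible C M N t \<longleftrightarrow> natural C M N t \<and>
     (\<exists>s. natural C N M s \<and>
        (\<forall>A\<in>C. \<forall>x\<in>el M A. s A (t A x) = x) \<and>
        (\<forall>A\<in>C. \<forall>y\<in>el N A. t A (s A y) = y))"

abbreviation symmetric_set :: "'a psh \<Rightarrow> bool" where
  "symmetric_set \<equiv> presheaf (F_obs Pinf)"

definition restr :: "nat extended \<Rightarrow> 'a psh \<Rightarrow> 'a psh" where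
  "restr l M = \<lparr>el = (\<lambda>K\<in>F_obs l. el M K), act = (\<lambda>K\<in>F_obs l. \<lambda>L\<in>F_obs l. act M K L)\<rparr>"


subsection \<open>Left Kan extension\<close>

text \<open>
  At \<open>A\<close> this is the coend of \<open>F(A, K) \<times> X(K)\<close> over \<open>K\<close> in the subcategory: triples \<open>(K, f, x)\<close>
  modulo the equivalence relation generated by \<open>Lan_step\<close>.
\<close>

definition Lan_pre :: "nat extended \<Rightarrow> 'a psh \<Rightarrow> nat set \<Rightarrow> (nat set \<times> (nat \<Rightarrow> nat) \<times> 'a) set" where
  "Lan_pre l X A = (SIGMA K:F_obs l. (A \<rightarrow>\<^sub>E K) \<times> el X K)"

definition Lan_step :: "nat extended \<Rightarrow> 'a psh \<Rightarrow> nat set \<Rightarrow>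
    nat set \<times> (nat \<Rightarrow> nat) \<times> 'a \<Rightarrow> nat set \<times> (nat \<Rightarrow> nat) \<times> 'a \<Rightarrow> bool" where
  "Lan_step l X A p q \<longleftrightarrow>
     (\<exists>K\<in>F_obs l. \<exists>L\<in>F_obs l. \<exists>f\<in>A \<rightarrow>\<^sub>E K. \<exists>h\<in>K \<rightarrow>\<^sub>E L. \<exists>y\<in>el X L.
        p = (K, f, act X K L h y) \<and> q = (L, compose A h f, y))"

definition Lan_eq :: "nat extended \<Rightarrow> 'a psh \<Rightarrow> nat set \<Rightarrow> (nat set \<times> (nat \<Rightarrow> nat) \<times> 'a) rel" where
  "Lan_eq l X A = {(p, q). p \<in> Lan_pre l X A \<and> q \<in> Lan_pre l X A \<and> equivclp (Lan_step l X A) p q}"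

definition Lan :: "nat extended \<Rightarrow> 'a psh \<Rightarrow> (nat set \<times> (nat \<Rightarrow> nat) \<times> 'a) set psh" where
  "Lan l X = \<lparr>el = (\<lambda>A. Lan_pre l X A // Lan_eq l X A),
     act = (\<lambda>A B g c. \<Union>(K, f, x)\<in>c. Lan_eq l X A `` {(K, compose A f g, x)})\<rparr>"

definition Lan_unit ::
    "nat extended \<Rightarrow> 'a psh \<Rightarrow> nat set \<Rightarrow> 'a \<Rightarrow> (nat set \<times> (nat \<Rightarrow> nat) \<times> 'a) set" where
  "Lan_unit l X K x = Lan_eq l X K `` {(K, \<lambda>k\<in>K. k, x)}"

text \<open>The transpose \<open>Lan l X \<rightarrow> Y\<close> of \<open>t : X \<rightarrow> restr l Y\<close>.\<close>

definition Lan_transpose :: "'b psh \<Rightarrow> (nat set \<Rightarrow> 'a \<Rightarrow> 'b) \<Rightarrow>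
    nat set \<Rightarrow> (nat set \<times> (nat \<Rightarrow> nat) \<times> 'a) set \<Rightarrow> 'b" where
  "Lan_transpose Y t A c = the_elem ((\<lambda>(K, f, x). act Y A K f (t K x)) ` c)"


subsection \<open>Right Kan extension\<close>

text \<open>
  At \<open>A\<close> this is the set of natural transformations from the restriction of the representable
  \<open>F(-, A)\<close> to \<open>X\<close>.
\<close>

definition Ran :: "nat extended \<Rightarrow> 'a psh \<Rightarrow> (nat set \<Rightarrow> (nat \<Rightarrow> nat) \<Rightarrow> 'a) psh" where
  "Ran l X = \<lparr>el = (\<lambda>A. {\<phi> \<in> (\<Pi>\<^sub>E K\<in>F_obs l. (K \<rightarrow>\<^sub>E A) \<rightarrow>\<^sub>E el X K).
        \<forall>K\<in>F_obs l. \<forall>L\<in>F_obs l. \<forall>h\<in>K \<rightarrow>\<^sub>E L. \<forall>f\<in>L \<rightarrow>\<^sub>E A.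
          \<phi> K (compose K f h) = act X K L h (\<phi> L f)}),
     act = (\<lambda>A B g \<phi>. \<lambda>K\<in>F_obs l. \<lambda>f\<in>K \<rightarrow>\<^sub>E A. \<phi> K (compose K g f))\<rparr>"

definition Ran_counit :: "nat set \<Rightarrow> (nat set \<Rightarrow> (nat \<Rightarrow> nat) \<Rightarrow> 'a) \<Rightarrow> 'a" where
  "Ran_counit K \<phi> = \<phi> K (\<lambda>k\<in>K. k)"

text \<open>The transpose \<open>Y \<rightarrow> Ran l X\<close> of \<open>t : restr l Y \<rightarrow> X\<close>.\<close>

definition Ran_transpose :: "nat extended \<Rightarrow> 'b psh \<Rightarrow> (nat set \<Rightarrow> 'b \<Rightarrow> 'a) \<Rightarrow>
    nat set \<Rightarrow> 'b \<Rightarrow> (nat set \<Rightarrow> (nat \<Rightarrow> nat) \<Rightarrow> 'a)" where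
  "Ran_transpose l Y t A y = (\<lambda>K\<in>F_obs l. \<lambda>f\<in>K \<rightarrow>\<^sub>E A. t K (act Y K A f y))"


subsection \<open>Skeletal and coskeletal symmetric sets\<close>

text \<open>
  The counit of sk and the unit of cosk at \<open>M\<close> are the transposes of the identity of \<open>restr l M\<close>.
\<close>

definition sk :: "nat extended \<Rightarrow> 'a psh \<Rightarrow> (nat set \<times> (nat \<Rightarrow> nat) \<times> 'a) set psh" where
  "sk l M = Lan l (restr l M)"

definition sk_counit ::
    "'a psh \<Rightarrow> nat set \<Rightarrow> (nat set \<times> (nat \<Rightarrow> nat) \<times> 'a) set \<Rightarrow> 'a" where
  "sk_counit M = Lan_transpose M (\<lambda>K x. x)"

definition cosk :: "nat extended \<Rightarrow> 'a psh \<Rightarrow> (nat set \<Rightarrow> (nat \<Rightarrow> nat) \<Rightarrow> 'a) psh" where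
  "cosk l M = Ran l (restr l M)"

definition cosk_unit ::
    "nat extended \<Rightarrow> 'a psh \<Rightarrow> nat set \<Rightarrow> 'a \<Rightarrow> (nat set \<Rightarrow> (nat \<Rightarrow> nat) \<Rightarrow> 'a)" where
  "cosk_unit l M = Ran_transpose l M (\<lambda>K x. x)"

definition skeletal :: "nat extended \<Rightarrow> 'a psh \<Rightarrow> bool" where
  "skeletal l M \<longleftrightarrow> invertible (F_obs Pinf) (sk l M) M (sk_counit M)"

definition coskeletal :: "nat extended \<Rightarrow> 'a psh \<Rightarrow> bool" where
  "coskeletal l M \<longleftrightarrow> invertible (F_obs Pinf) M (cosk l M) (cosk_unit l M)"

text \<open>
  HOL cannot quantify over types inside a formula, so the universe \<open>'a\<close> from which the elements
  of symmetric sets are taken is a parameter.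
\<close>

definition skeletal_imp_coskeletal :: "'a itself \<Rightarrow> nat extended \<Rightarrow> nat extended \<Rightarrow> bool" where
  "skeletal_imp_coskeletal _ l a \<longleftrightarrow>
     (\<forall>M :: 'a psh. symmetric_set M \<longrightarrow> skeletal l M \<longrightarrow> coskeletal a M)"

definition is_Aufhebung :: "'a itself \<Rightarrow> nat extended \<Rightarrow> nat extended \<Rightarrow> bool" where
  "is_Aufhebung T l a \<longleftrightarrow>
     l \<le> a \<and> skeletal_imp_coskeletal T l a \<and>
     (\<forall>b. l \<le> b \<and> skeletal_imp_coskeletal T l b \<longrightarrow> a \<le> b)"


subsection \<open>The adjunctions\<close>

lemma F_obs_mono: "l \<le> m \<Longrightarrow> F_obs l \<subseteq> F_obs m"
  by (cases l; cases m) (auto simp: F_obs_def)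

lemma F_obs_Pinf: "K \<in> F_obs l \<Longrightarrow> K \<in> F_obs Pinf"
  using F_obs_mono[of l Pinf] by auto

lemma compose_PiE: "f \<in> A \<rightarrow>\<^sub>E B \<Longrightarrow> g \<in> B \<rightarrow>\<^sub>E D \<Longrightarrow> compose A g f \<in> A \<rightarrow>\<^sub>E D"
  by (auto simp: compose_def PiE_iff)

lemma compose_assoc': "f \<in> A \<rightarrow>\<^sub>E B \<Longrightarrow> compose A h (compose A g f) = compose A (compose B h g) f"
  by (auto simp: compose_def PiE_iff fun_eq_iff)

lemma id_PiE: "(\<lambda>a\<in>A. a) \<in> A \<rightarrow>\<^sub>E A"
  by auto

lemma compose_Id': "g \<in> A \<rightarrow>\<^sub>E B \<Longrightarrow> compose A g (\<lambda>a\<in>A. a) = g"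
  by (auto simp: compose_def PiE_iff fun_eq_iff extensional_def)

lemma Id_compose': "g \<in> A \<rightarrow>\<^sub>E B \<Longrightarrow> compose A (\<lambda>a\<in>B. a) g = g"
  by (auto simp: compose_def PiE_iff fun_eq_iff extensional_def)

lemma presheaf_act:
  "presheaf C M \<Longrightarrow> A \<in> C \<Longrightarrow> B \<in> C \<Longrightarrow> f \<in> A \<rightarrow>\<^sub>E B \<Longrightarrow> x \<in> el M B \<Longrightarrow> act M A B f x \<in> el M A"
  unfolding presheaf_def by blast

lemma presheaf_id: "presheaf C M \<Longrightarrow> A \<in> C \<Longrightarrow> x \<in> el M A \<Longrightarrow> act M A A (\<lambda>a\<in>A. a) x = x"
  unfolding presheaf_def by blast

lemma presheaf_comp:
  "presheaf C M \<Longrightarrow> A \<in> C \<Longrightarrow> B \<in> C \<Longrightarrow> D \<in> C \<Longrightarrow> f \<in> A \<rightarrow>\<^sub>E B \<Longrightarrow> g \<in> B \<rightarrow>\<^sub>E D \<Longrightarrow> x \<in> el M D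
   \<Longrightarrow> act M A D (compose A g f) x = act M A B f (act M B D g x)"
  unfolding presheaf_def by blast

lemma el_restr [simp]: "K \<in> F_obs l \<Longrightarrow> el (restr l M) K = el M K"
  by (simp add: restr_def)

lemma act_restr [simp]:
  "K \<in> F_obs l \<Longrightarrow> L \<in> F_obs l \<Longrightarrow> act (restr l M) K L = act M K L"
  by (simp add: restr_def)

lemma presheaf_restr:
  assumes "symmetric_set M"
  shows "presheaf (F_obs l) (restr l M)"
  unfolding presheaf_def
  by (simp add: F_obs_Pinf presheaf_act[OF assms] presheaf_id[OF assms] presheaf_comp[OF assms])

lemma equiv_Lan_eq: "equiv (Lan_pre l X A) (Lan_eq l X A)"
proof (rule equivI)
  show "Lan_eq l X A \<subseteq> Lan_pre l X A \<times> Lan_pre l X A" by (auto simp: Lan_eq_def)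
  show "refl_on (Lan_pre l X A) (Lan_eq l X A)" by (auto simp: refl_on_def Lan_eq_def)
  show "sym (Lan_eq l X A)" by (auto simp: sym_def Lan_eq_def intro: equivclp_sym)
  show "trans (Lan_eq l X A)" by (auto simp: trans_def Lan_eq_def intro: equivclp_trans)
qed

lemma Lan_eq_respects:
  assumes "(p, q) \<in> Lan_eq l X A"
    and "\<And>p q. Lan_step l X A p q \<Longrightarrow> \<psi> p = \<psi> q"
  shows "\<psi> p = \<psi> q"
proof -
  have "equivclp (Lan_step l X A) p q" using assms(1) by (simp add: Lan_eq_def)
  then show ?thesis
    by (induction rule: equivclp_induct) (use assms(2) in auto)
qed

lemma Lan_step_pre:
  assumes "presheaf (F_obs l) X" and "Lan_step l X A p q"
  shows "p \<in> Lan_pre l X A" "q \<in> Lan_pre l X A"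
proof -
  from assms(2) obtain K L f h y where "K \<in> F_obs l" "L \<in> F_obs l" "f \<in> A \<rightarrow>\<^sub>E K" "h \<in> K \<rightarrow>\<^sub>E L"
      "y \<in> el X L" "p = (K, f, act X K L h y)" "q = (L, compose A h f, y)"
    unfolding Lan_step_def by blast
  then show "p \<in> Lan_pre l X A" "q \<in> Lan_pre l X A"
    by (simp_all add: Lan_pre_def presheaf_act[OF assms(1)] compose_PiE)
qed

lemma Lan_step_eq:
  assumes "presheaf (F_obs l) X" and "Lan_step l X A p q"
  shows "(p, q) \<in> Lan_eq l X A"
  using Lan_step_pre[OF assms] assms(2) by (auto simp: Lan_eq_def)

lemma Lan_step_precompose:
  assumes "g \<in> A \<rightarrow>\<^sub>E B" and "Lan_step l X B (K, f, x) (K', f', x')"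
  shows "Lan_step l X A (K, compose A f g, x) (K', compose A f' g, x')"
proof -
  from assms(2) obtain h where *: "K \<in> F_obs l" "K' \<in> F_obs l" "f \<in> B \<rightarrow>\<^sub>E K" "h \<in> K \<rightarrow>\<^sub>E K'"
      "x' \<in> el X K'" "x = act X K K' h x'" "f' = compose B h f"
    unfolding Lan_step_def by blast
  have "compose A f' g = compose A h (compose A f g)"
    using assms(1) *(7) by (simp add: compose_assoc')
  then show ?thesis
    unfolding Lan_step_def using * compose_PiE[OF assms(1) *(3)] by blast
qed

lemma act_Lan:
  assumes X: "presheaf (F_obs l) X" and g: "g \<in> A \<rightarrow>\<^sub>E B"
    and p: "K \<in> F_obs l" "f \<in> B \<rightarrow>\<^sub>E K" "x \<in> el X K"
  shows "act (Lan l X) A B g (Lan_eq l X B `` {(K, f, x)}) = Lan_eq l X A `` {(K, compose A f g, x)}"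
proof -
  let ?\<psi> = "\<lambda>(K, f, x). Lan_eq l X A `` {(K, compose A f g, x)}"
  have step: "?\<psi> p = ?\<psi> q" if "Lan_step l X B p q" for p q
    using that equiv_class_eq[OF equiv_Lan_eq Lan_step_eq[OF X Lan_step_precompose[OF g]]]
    by (cases p; cases q) auto
  have "?\<psi> q = ?\<psi> (K, f, x)" if "q \<in> Lan_eq l X B `` {(K, f, x)}" for q
    using Lan_eq_respects[of "(K, f, x)" q l X B ?\<psi>] step that by auto
  moreover have "(K, f, x) \<in> Lan_eq l X B `` {(K, f, x)}"
    using p by (simp add: Lan_eq_def Lan_pre_def)
  ultimately have "(\<Union>q\<in>Lan_eq l X B `` {(K, f, x)}. ?\<psi> q) = ?\<psi> (K, f, x)"
    by blast
  then show ?thesis by (simp add: Lan_def case_prod_unfold)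
qed

lemma el_LanE:
  assumes "c \<in> el (Lan l X) A"
  obtains K f x where "K \<in> F_obs l" "f \<in> A \<rightarrow>\<^sub>E K" "x \<in> el X K" "c = Lan_eq l X A `` {(K, f, x)}"
proof -
  from assms obtain p where "p \<in> Lan_pre l X A" "c = Lan_eq l X A `` {p}"
    by (auto simp: Lan_def elim: quotientE)
  moreover obtain K f x where "p = (K, f, x)" by (cases p)
  ultimately show thesis using that[of K f x] by (simp add: Lan_pre_def)
qed

lemma el_LanI:
  "K \<in> F_obs l \<Longrightarrow> f \<in> A \<rightarrow>\<^sub>E K \<Longrightarrow> x \<in> el X K \<Longrightarrow> Lan_eq l X A `` {(K, f, x)} \<in> el (Lan l X) A"
  by (simp add: Lan_def Lan_pre_def quotientI)

lemma presheaf_Lan: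
  assumes X: "presheaf (F_obs l) X"
  shows "symmetric_set (Lan l X)"
  unfolding presheaf_def
proof (intro conjI ballI)
  fix A B :: "nat set" and g :: "nat \<Rightarrow> nat" and c
  assume "g \<in> A \<rightarrow>\<^sub>E B" "c \<in> el (Lan l X) B"
  then show "act (Lan l X) A B g c \<in> el (Lan l X) A"
    by (elim el_LanE) (simp add: act_Lan[OF X] el_LanI compose_PiE)
next
  fix A :: "nat set" and c
  assume "c \<in> el (Lan l X) A"
  then show "act (Lan l X) A A (\<lambda>a\<in>A. a) c = c"
    by (elim el_LanE) (simp add: act_Lan[OF X id_PiE] compose_Id')
next
  fix A B D :: "nat set" and f g :: "nat \<Rightarrow> nat" and c
  assume f: "f \<in> A \<rightarrow>\<^sub>E B" and g: "g \<in> B \<rightarrow>\<^sub>E D" and "c \<in> el (Lan l X) D"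
  then obtain K h x where "K \<in> F_obs l" "h \<in> D \<rightarrow>\<^sub>E K" "x \<in> el X K" "c = Lan_eq l X D `` {(K, h, x)}"
    by (elim el_LanE)
  then show "act (Lan l X) A D (compose A g f) c = act (Lan l X) A B f (act (Lan l X) B D g c)"
    using f g by (simp add: act_Lan[OF X] compose_PiE compose_assoc'[OF f])
qed

lemma natural_Lan_unit:
  assumes X: "presheaf (F_obs l) X"
  shows "natural (F_obs l) X (restr l (Lan l X)) (Lan_unit l X)"
  unfolding natural_def
proof (intro conjI ballI)
  fix K :: "nat set" and x
  assume "K \<in> F_obs l" "x \<in> el X K"
  then show "Lan_unit l X K x \<in> el (restr l (Lan l X)) K"
    by (simp add: Lan_unit_def el_LanI id_PiE)
next
  fix K L :: "nat set" and h :: "nat \<Rightarrow> nat" and x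
  assume *: "K \<in> F_obs l" "L \<in> F_obs l" "h \<in> K \<rightarrow>\<^sub>E L" "x \<in> el X L"
  have "Lan_step l X K (K, \<lambda>k\<in>K. k, act X K L h x) (L, compose K h (\<lambda>k\<in>K. k), x)"
    unfolding Lan_step_def using *
    by (intro bexI[of _ K] bexI[of _ L] bexI[of _ "\<lambda>k\<in>K. k"] bexI[of _ h] bexI[of _ x])
      (simp_all add: id_PiE)
  then have "Lan_eq l X K `` {(K, \<lambda>k\<in>K. k, act X K L h x)} = Lan_eq l X K `` {(L, h, x)}"
    using equiv_class_eq[OF equiv_Lan_eq Lan_step_eq[OF X]] *(3) by (simp add: compose_Id')
  then show "Lan_unit l X K (act X K L h x) = act (restr l (Lan l X)) K L h (Lan_unit l X L x)"
    using * by (simp add: Lan_unit_def act_Lan[OF X] Id_compose')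
qed

lemma Lan_transpose_class:
  assumes X: "presheaf (F_obs l) X" and Y: "symmetric_set Y"
    and t: "natural (F_obs l) X (restr l Y) t"
    and A: "A \<in> F_obs Pinf" and p: "K \<in> F_obs l" "f \<in> A \<rightarrow>\<^sub>E K" "x \<in> el X K"
  shows "Lan_transpose Y t A (Lan_eq l X A `` {(K, f, x)}) = act Y A K f (t K x)"
proof -
  let ?\<psi> = "\<lambda>(K, f, x). act Y A K f (t K x)"
  have step: "?\<psi> p = ?\<psi> q" if pq: "Lan_step l X A p q" for p q
  proof -
    from pq obtain K L f h y where *: "K \<in> F_obs l" "L \<in> F_obs l" "f \<in> A \<rightarrow>\<^sub>E K" "h \<in> K \<rightarrow>\<^sub>E L"
        "y \<in> el X L" "p = (K, f, act X K L h y)" "q = (L, compose A h f, y)"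
      unfolding Lan_step_def by blast
    have "t L y \<in> el Y L" "t K (act X K L h y) = act Y K L h (t L y)"
      using t * unfolding natural_def by auto
    then show ?thesis
      using * presheaf_comp[OF Y A _ _ *(3,4)] by (simp add: F_obs_Pinf)
  qed
  have "?\<psi> q = ?\<psi> (K, f, x)" if "q \<in> Lan_eq l X A `` {(K, f, x)}" for q
    using Lan_eq_respects[of "(K, f, x)" q l X A ?\<psi>] step that by auto
  moreover have "(K, f, x) \<in> Lan_eq l X A `` {(K, f, x)}"
    using p by (simp add: Lan_eq_def Lan_pre_def)
  ultimately have "?\<psi> ` (Lan_eq l X A `` {(K, f, x)}) = {?\<psi> (K, f, x)}"
    by blast
  then show ?thesis by (simp add: Lan_transpose_def)
qed

theorem Lan_left_adjoint:
  assumes X: "presheaf (F_obs l) X" and Y: "symmetric_set Y"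
    and t: "natural (F_obs l) X (restr l Y) t"
  shows "natural (F_obs Pinf) (Lan l X) Y (Lan_transpose Y t)"
    and "\<forall>K\<in>F_obs l. \<forall>x\<in>el X K. Lan_transpose Y t K (Lan_unit l X K x) = t K x"
    and "natural (F_obs Pinf) (Lan l X) Y u \<Longrightarrow>
         \<forall>K\<in>F_obs l. \<forall>x\<in>el X K. u K (Lan_unit l X K x) = t K x \<Longrightarrow>
         \<forall>A\<in>F_obs Pinf. \<forall>c\<in>el (Lan l X) A. u A c = Lan_transpose Y t A c"
proof -
  have tY: "t K x \<in> el Y K" if "K \<in> F_obs l" "x \<in> el X K" for K x
    using t that unfolding natural_def by auto
  show "natural (F_obs Pinf) (Lan l X) Y (Lan_transpose Y t)"
    unfolding natural_def
  proof (intro conjI ballI)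
    fix A :: "nat set" and c
    assume "A \<in> F_obs Pinf" "c \<in> el (Lan l X) A"
    then show "Lan_transpose Y t A c \<in> el Y A"
      by (elim el_LanE)
        (simp add: Lan_transpose_class[OF X Y t] F_obs_Pinf tY presheaf_act[OF Y])
  next
    fix A B :: "nat set" and g :: "nat \<Rightarrow> nat" and c
    assume A: "A \<in> F_obs Pinf" and B: "B \<in> F_obs Pinf" and g: "g \<in> A \<rightarrow>\<^sub>E B"
      and "c \<in> el (Lan l X) B"
    then obtain K f x where *: "K \<in> F_obs l" "f \<in> B \<rightarrow>\<^sub>E K" "x \<in> el X K"
        "c = Lan_eq l X B `` {(K, f, x)}"
      by (elim el_LanE)
    then show "Lan_transpose Y t A (act (Lan l X) A B g c) = act Y A B g (Lan_transpose Y t B c)"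
      using A B g compose_PiE[OF g *(2)] tY presheaf_comp[OF Y A B F_obs_Pinf[OF *(1)] g *(2)]
      by (simp add: act_Lan[OF X] Lan_transpose_class[OF X Y t])
  qed
  show "\<forall>K\<in>F_obs l. \<forall>x\<in>el X K. Lan_transpose Y t K (Lan_unit l X K x) = t K x"
    by (simp add: Lan_unit_def Lan_transpose_class[OF X Y t] F_obs_Pinf presheaf_id[OF Y] tY id_PiE)
  assume u: "natural (F_obs Pinf) (Lan l X) Y u"
    and ut: "\<forall>K\<in>F_obs l. \<forall>x\<in>el X K. u K (Lan_unit l X K x) = t K x"
  show "\<forall>A\<in>F_obs Pinf. \<forall>c\<in>el (Lan l X) A. u A c = Lan_transpose Y t A c"
  proof (intro ballI)
    fix A :: "nat set" and c
    assume A: "A \<in> F_obs Pinf" and "c \<in> el (Lan l X) A"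
    then obtain K f x where *: "K \<in> F_obs l" "f \<in> A \<rightarrow>\<^sub>E K" "x \<in> el X K"
        "c = Lan_eq l X A `` {(K, f, x)}"
      by (elim el_LanE)
    have "act (Lan l X) A K f (Lan_unit l X K x) = c"
      using * by (simp add: Lan_unit_def act_Lan[OF X] id_PiE Id_compose')
    moreover have "Lan_unit l X K x \<in> el (Lan l X) K"
      using * by (simp add: Lan_unit_def el_LanI id_PiE)
    then have "u A (act (Lan l X) A K f (Lan_unit l X K x)) = act Y A K f (u K (Lan_unit l X K x))"
      using u A F_obs_Pinf[OF *(1)] *(2) unfolding natural_def by blast
    ultimately show "u A c = Lan_transpose Y t A c"
      using * ut A by (simp add: Lan_transpose_class[OF X Y t])
  qed
qed

lemma Ran_ext:
  assumes "\<phi> \<in> el (Ran l X) A" "\<psi> \<in> el (Ran l X) A"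
    and "\<And>K f. K \<in> F_obs l \<Longrightarrow> f \<in> K \<rightarrow>\<^sub>E A \<Longrightarrow> \<phi> K f = \<psi> K f"
  shows "\<phi> = \<psi>"
proof (rule PiE_ext)
  show 1: "\<phi> \<in> (\<Pi>\<^sub>E K\<in>F_obs l. (K \<rightarrow>\<^sub>E A) \<rightarrow>\<^sub>E el X K)"
    using assms(1) by (simp add: Ran_def)
  show 2: "\<psi> \<in> (\<Pi>\<^sub>E K\<in>F_obs l. (K \<rightarrow>\<^sub>E A) \<rightarrow>\<^sub>E el X K)"
    using assms(2) by (simp add: Ran_def)
  fix K :: "nat set"
  assume K: "K \<in> F_obs l"
  show "\<phi> K = \<psi> K"
    by (rule PiE_ext[OF PiE_mem[OF 1 K] PiE_mem[OF 2 K]]) (rule assms(3)[OF K])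
qed

lemma el_Ran_mem:
  "\<phi> \<in> el (Ran l X) A \<Longrightarrow> K \<in> F_obs l \<Longrightarrow> f \<in> K \<rightarrow>\<^sub>E A \<Longrightarrow> \<phi> K f \<in> el X K"
  by (auto simp: Ran_def)

lemma el_Ran_natural:
  "\<phi> \<in> el (Ran l X) A \<Longrightarrow> K \<in> F_obs l \<Longrightarrow> L \<in> F_obs l \<Longrightarrow> h \<in> K \<rightarrow>\<^sub>E L \<Longrightarrow> f \<in> L \<rightarrow>\<^sub>E A \<Longrightarrow>
   \<phi> K (compose K f h) = act X K L h (\<phi> L f)"
  by (simp add: Ran_def)

lemma act_Ran:
  "K \<in> F_obs l \<Longrightarrow> f \<in> K \<rightarrow>\<^sub>E A \<Longrightarrow> act (Ran l X) A B g \<phi> K f = \<phi> K (compose K g f)"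
  by (simp add: Ran_def)

lemma act_Ran_mem:
  assumes g: "g \<in> A \<rightarrow>\<^sub>E B" and \<phi>: "\<phi> \<in> el (Ran l X) B"
  shows "act (Ran l X) A B g \<phi> \<in> el (Ran l X) A"
proof -
  have 1: "act (Ran l X) A B g \<phi> \<in> (\<Pi>\<^sub>E K\<in>F_obs l. (K \<rightarrow>\<^sub>E A) \<rightarrow>\<^sub>E el X K)"
    by (simp add: Ran_def restrict_PiE_iff el_Ran_mem[OF \<phi>] compose_PiE[OF _ g] del: restrict_PiE)
  have 2: "act (Ran l X) A B g \<phi> K (compose K f h) = act X K L h (act (Ran l X) A B g \<phi> L f)"
    if "K \<in> F_obs l" "L \<in> F_obs l" "h \<in> K \<rightarrow>\<^sub>E L" "f \<in> L \<rightarrow>\<^sub>E A" for K L h f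
    using that el_Ran_natural[OF \<phi> that(1-3) compose_PiE[OF that(4) g]]
    by (simp add: act_Ran compose_PiE compose_assoc'[OF that(3)])
  show ?thesis using 1 2 by (subst Ran_def) simp
qed

lemma presheaf_Ran: "symmetric_set (Ran l X)"
  unfolding presheaf_def
proof (intro conjI ballI)
  fix A B :: "nat set" and g :: "nat \<Rightarrow> nat" and \<phi>
  assume "g \<in> A \<rightarrow>\<^sub>E B" "\<phi> \<in> el (Ran l X) B"
  then show "act (Ran l X) A B g \<phi> \<in> el (Ran l X) A" by (rule act_Ran_mem)
next
  fix A :: "nat set" and \<phi>
  assume "\<phi> \<in> el (Ran l X) A"
  then show "act (Ran l X) A A (\<lambda>a\<in>A. a) \<phi> = \<phi>"
    by (intro Ran_ext[OF act_Ran_mem[OF id_PiE]]) (simp_all add: act_Ran Id_compose')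
next
  fix A B D :: "nat set" and f g :: "nat \<Rightarrow> nat" and \<phi>
  assume fg: "f \<in> A \<rightarrow>\<^sub>E B" "g \<in> B \<rightarrow>\<^sub>E D" and \<phi>: "\<phi> \<in> el (Ran l X) D"
  show "act (Ran l X) A D (compose A g f) \<phi> = act (Ran l X) A B f (act (Ran l X) B D g \<phi>)"
  proof (rule Ran_ext)
    show "act (Ran l X) A D (compose A g f) \<phi> \<in> el (Ran l X) A"
      "act (Ran l X) A B f (act (Ran l X) B D g \<phi>) \<in> el (Ran l X) A"
      using fg \<phi> by (simp_all add: act_Ran_mem compose_PiE)
    fix K :: "nat set" and k :: "nat \<Rightarrow> nat"
    assume k: "K \<in> F_obs l" "k \<in> K \<rightarrow>\<^sub>E A"
    then show "act (Ran l X) A D (compose A g f) \<phi> K k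
        = act (Ran l X) A B f (act (Ran l X) B D g \<phi>) K k"
      using fg by (simp add: act_Ran compose_PiE compose_assoc'[OF k(2)])
  qed
qed

lemma natural_Ran_counit: "natural (F_obs l) (restr l (Ran l X)) X Ran_counit"
  unfolding natural_def
proof (intro conjI ballI)
  fix K :: "nat set" and \<phi>
  assume "K \<in> F_obs l" "\<phi> \<in> el (restr l (Ran l X)) K"
  then show "Ran_counit K \<phi> \<in> el X K"
    using el_Ran_mem[OF _ _ id_PiE] by (simp add: Ran_counit_def)
next
  fix K L :: "nat set" and h :: "nat \<Rightarrow> nat" and \<phi>
  assume *: "K \<in> F_obs l" "L \<in> F_obs l" "h \<in> K \<rightarrow>\<^sub>E L" "\<phi> \<in> el (restr l (Ran l X)) L"
  then have "\<phi> K (compose K (\<lambda>a\<in>L. a) h) = act X K L h (\<phi> L (\<lambda>a\<in>L. a))"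
    using el_Ran_natural[OF _ _ _ _ id_PiE] by simp
  then show "Ran_counit K (act (restr l (Ran l X)) K L h \<phi>) = act X K L h (Ran_counit L \<phi>)"
    using * by (simp add: Ran_counit_def act_Ran id_PiE Id_compose' compose_Id')
qed

theorem Ran_right_adjoint:
  assumes Y: "symmetric_set Y" and t: "natural (F_obs l) (restr l Y) X t"
  shows "natural (F_obs Pinf) Y (Ran l X) (Ran_transpose l Y t)"
    and "\<forall>K\<in>F_obs l. \<forall>y\<in>el Y K. Ran_counit K (Ran_transpose l Y t K y) = t K y"
    and "natural (F_obs Pinf) Y (Ran l X) u \<Longrightarrow>
         \<forall>K\<in>F_obs l. \<forall>y\<in>el Y K. Ran_counit K (u K y) = t K y \<Longrightarrow>
         \<forall>A\<in>F_obs Pinf. \<forall>y\<in>el Y A. u A y = Ran_transpose l Y t A y"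
proof -
  have tX: "t K y \<in> el X K" if "K \<in> F_obs l" "y \<in> el Y K" for K y
    using t that unfolding natural_def by auto
  have tnat: "t K (act Y K L h y) = act X K L h (t L y)"
    if "K \<in> F_obs l" "L \<in> F_obs l" "h \<in> K \<rightarrow>\<^sub>E L" "y \<in> el Y L" for K L h y
    using t that unfolding natural_def by auto
  have mem: "Ran_transpose l Y t A y \<in> el (Ran l X) A" if A: "A \<in> F_obs Pinf" "y \<in> el Y A" for A y
  proof -
    have 1: "Ran_transpose l Y t A y \<in> (\<Pi>\<^sub>E K\<in>F_obs l. (K \<rightarrow>\<^sub>E A) \<rightarrow>\<^sub>E el X K)"
      using A by (simp add: Ran_transpose_def restrict_PiE_iff tX presheaf_act[OF Y] F_obs_Pinf
          del: restrict_PiE)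
    have 2: "Ran_transpose l Y t A y K (compose K f h) = act X K L h (Ran_transpose l Y t A y L f)"
      if "K \<in> F_obs l" "L \<in> F_obs l" "h \<in> K \<rightarrow>\<^sub>E L" "f \<in> L \<rightarrow>\<^sub>E A" for K L h f
      using that A presheaf_comp[OF Y F_obs_Pinf F_obs_Pinf A(1) that(3,4) A(2)]
        presheaf_act[OF Y F_obs_Pinf A(1) that(4) A(2)]
      by (simp add: Ran_transpose_def compose_PiE tnat)
    show ?thesis using 1 2 by (subst Ran_def) simp
  qed
  show nat: "natural (F_obs Pinf) Y (Ran l X) (Ran_transpose l Y t)"
    unfolding natural_def
  proof (intro conjI ballI)
    fix A :: "nat set" and y
    assume "A \<in> F_obs Pinf" "y \<in> el Y A"
    then show "Ran_transpose l Y t A y \<in> el (Ran l X) A" by (rule mem)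
  next
    fix A B :: "nat set" and g :: "nat \<Rightarrow> nat" and y
    assume *: "A \<in> F_obs Pinf" "B \<in> F_obs Pinf" "g \<in> A \<rightarrow>\<^sub>E B" "y \<in> el Y B"
    show "Ran_transpose l Y t A (act Y A B g y) = act (Ran l X) A B g (Ran_transpose l Y t B y)"
    proof (rule Ran_ext)
      show "Ran_transpose l Y t A (act Y A B g y) \<in> el (Ran l X) A"
        using * by (intro mem presheaf_act[OF Y])
      show "act (Ran l X) A B g (Ran_transpose l Y t B y) \<in> el (Ran l X) A"
        using * by (intro act_Ran_mem mem)
      fix K :: "nat set" and k :: "nat \<Rightarrow> nat"
      assume k: "K \<in> F_obs l" "k \<in> K \<rightarrow>\<^sub>E A"
      then show "Ran_transpose l Y t A (act Y A B g y) K k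
          = act (Ran l X) A B g (Ran_transpose l Y t B y) K k"
        using * presheaf_comp[OF Y F_obs_Pinf[OF k(1)] *(1,2) k(2) *(3,4)] compose_PiE[OF k(2) *(3)]
        by (simp add: act_Ran Ran_transpose_def)
    qed
  qed
  show "\<forall>K\<in>F_obs l. \<forall>y\<in>el Y K. Ran_counit K (Ran_transpose l Y t K y) = t K y"
    by (simp add: Ran_counit_def Ran_transpose_def id_PiE F_obs_Pinf presheaf_id[OF Y])
  assume u: "natural (F_obs Pinf) Y (Ran l X) u"
    and ut: "\<forall>K\<in>F_obs l. \<forall>y\<in>el Y K. Ran_counit K (u K y) = t K y"
  show "\<forall>A\<in>F_obs Pinf. \<forall>y\<in>el Y A. u A y = Ran_transpose l Y t A y"
  proof (intro ballI)
    fix A :: "nat set" and y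
    assume A: "A \<in> F_obs Pinf" "y \<in> el Y A"
    show "u A y = Ran_transpose l Y t A y"
    proof (rule Ran_ext)
      show "u A y \<in> el (Ran l X) A" using u A unfolding natural_def by blast
      show "Ran_transpose l Y t A y \<in> el (Ran l X) A" using A by (rule mem)
      fix K :: "nat set" and k :: "nat \<Rightarrow> nat"
      assume k: "K \<in> F_obs l" "k \<in> K \<rightarrow>\<^sub>E A"
      have "u K (act Y K A k y) = act (Ran l X) K A k (u A y)"
        using u A k F_obs_Pinf[OF k(1)] unfolding natural_def by blast
      then have "Ran_counit K (u K (act Y K A k y)) = u A y K k"
        using k by (simp add: Ran_counit_def act_Ran id_PiE compose_Id')
      moreover have "act Y K A k y \<in> el Y K"
        using A k by (intro presheaf_act[OF Y]) (auto intro: F_obs_Pinf)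
      ultimately show "u A y K k = Ran_transpose l Y t A y K k"
        using ut k by (simp add: Ran_transpose_def)
    qed
  qed
qed

end

theory Submission
  imports Defs "HOL-Library.Countable_Set"
begin

text \<open>
  Every element \<open>x\<close> over \<open>A\<close> is pulled back along a retraction of \<open>A\<close> onto a subset \<open>T\<close> with
  nondegenerate restriction to \<open>T\<close>, and the possible \<open>T\<close> are the transversals of a partition of \<open>A\<close>
  determined by \<open>x\<close>. Thus \<open>M\<close> is \<open>l\<close>-skeletal iff these partitions have at most \<open>l + 1\<close> blocks, and
  then \<open>n\<close>-coskeletality for \<open>n \<ge> l\<close> says that every sphere, i.e. compatible family of elements
  \<open>x\<^sub>c\<close> over \<open>A - {c}\<close>, has a filler once \<open>A\<close> has at least \<open>n + 2\<close> elements.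

  A sphere has a filler as soon as two points \<open>a, b\<close> share a block of \<open>x\<^sub>c\<close> for all other \<open>c\<close>. Take a
  largest \<open>T\<close> on which the sphere is nondegenerate, \<open>b\<close> outside \<open>T\<close>, and \<open>a \<in> T\<close> in the block of \<open>b\<close>.
  If \<open>x\<^sub>c\<close> separates \<open>a\<close> from \<open>b\<close>, then each of its transversals through \<open>a\<close> and \<open>b\<close> contains all of
  \<open>A - T\<close>, so \<open>A\<close> has at most \<open>2 l + 1\<close> elements; equality is excluded for \<open>l \<ge> 3\<close> by an exchange
  argument between the transversals \<open>T\<close> and \<open>(A - T) \<union> {a}\<close>.

  For the lower bounds, \<open>M\<close> consists of the partitions into \<open>l + 1\<close> blocks and one degenerate element.
  For \<open>l \<ge> 3\<close>, split a set of \<open>2 l\<close> points into halves \<open>S, D\<close>; deleting a point of one half leaves the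
  partition with the rest of that half as one block and the points of the other half as singletons.
\<close>

subsection \<open>Eilenberg--Zilber decompositions\<close>

text \<open>With \<open>f\<close> restricted to \<open>A\<close>, arbitrary functions can stand for
  morphisms and compose as plain functions.\<close>

definition pull :: "'a psh \<Rightarrow> nat set \<Rightarrow> nat set \<Rightarrow> (nat \<Rightarrow> nat) \<Rightarrow> 'a \<Rightarrow> 'a" where
  "pull M A B f = act M A B (restrict f A)"

abbreviation res :: "'a psh \<Rightarrow> nat set \<Rightarrow> nat set \<Rightarrow> 'a \<Rightarrow> 'a" where
  "res M A S \<equiv> pull M S A (\<lambda>s. s)"

text \<open>A map that is not injective factors through a proper quotient onto its image, so
  admitting all \<open>g\<close> rather than only quotient maps still gives the usual nondegenerate
  elements.\<close>

definition nondeg :: "'a psh \<Rightarrow> nat set \<Rightarrow> 'a \<Rightarrow> bool" where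
  "nondeg M T y \<longleftrightarrow> (\<forall>B\<in>F_obs Pinf. \<forall>g\<in>T \<rightarrow> B. \<forall>z\<in>el M B. y = pull M T B g z \<longrightarrow> inj_on g T)"

text \<open>An Eilenberg--Zilber decomposition of \<open>x\<close>, with the quotient realised as a subset \<open>T\<close> of \<open>A\<close>.\<close>

definition basis :: "'a psh \<Rightarrow> nat set \<Rightarrow> 'a \<Rightarrow> nat set \<Rightarrow> (nat \<Rightarrow> nat) \<Rightarrow> bool" where
  "basis M A x T r \<longleftrightarrow> T \<subseteq> A \<and> T \<noteq> {} \<and> r \<in> A \<rightarrow> T \<and> (\<forall>t\<in>T. r t = t) \<and>
     pull M A T r (res M A T x) = x \<and> nondeg M T (res M A T x)"

lemma F_obs_Pinf_iff: "A \<in> F_obs Pinf \<longleftrightarrow> finite A \<and> A \<noteq> {}"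
  by (simp add: F_obs_def)

lemma F_obs_Fin_iff: "A \<in> F_obs (Fin n) \<longleftrightarrow> finite A \<and> A \<noteq> {} \<and> card A \<le> n + 1"
  by (simp add: F_obs_def)

lemma F_obs_Pinf_subset: "A \<in> F_obs Pinf \<Longrightarrow> S \<subseteq> A \<Longrightarrow> S \<noteq> {} \<Longrightarrow> S \<in> F_obs Pinf"
  by (auto simp: F_obs_Pinf_iff intro: finite_subset)

lemma pull_cong: "(\<And>a. a \<in> A \<Longrightarrow> f a = g a) \<Longrightarrow> pull M A B f x = pull M A B g x"
  unfolding pull_def by (metis restrict_ext)

lemma pull_act: "f \<in> A \<rightarrow>\<^sub>E B \<Longrightarrow> pull M A B f x = act M A B f x"
  by (simp add: pull_def PiE_restrict)

lemma nondegD: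
  assumes "nondeg M T (pull M T B g z)" "B \<in> F_obs Pinf" "g \<in> T \<rightarrow> B" "z \<in> el M B"
  shows "inj_on g T"
  using assms unfolding nondeg_def by blast

locale symset =
  fixes M :: "'a psh"
  assumes sym: "symmetric_set M"
begin

lemma pull_in: "A \<in> F_obs Pinf \<Longrightarrow> B \<in> F_obs Pinf \<Longrightarrow> f \<in> A \<rightarrow> B \<Longrightarrow> x \<in> el M B \<Longrightarrow> pull M A B f x \<in> el M A"
  unfolding pull_def by (rule presheaf_act[OF sym]) auto

lemma pull_id:
  assumes "A \<in> F_obs Pinf" "x \<in> el M A" "\<And>a. a \<in> A \<Longrightarrow> f a = a"
  shows "pull M A A f x = x"
proof -
  have "pull M A A f x = pull M A A (\<lambda>a. a) x" by (rule pull_cong) (simp add: assms)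
  then show ?thesis using presheaf_id[OF sym assms(1,2)] by (simp add: pull_def)
qed

lemma pull_pull:
  assumes "A \<in> F_obs Pinf" "B \<in> F_obs Pinf" "C \<in> F_obs Pinf" "f \<in> A \<rightarrow> B" "g \<in> B \<rightarrow> C" "x \<in> el M C"
  shows "pull M A B f (pull M B C g x) = pull M A C (\<lambda>a. g (f a)) x"
proof -
  have "compose A (restrict g B) (restrict f A) = restrict (\<lambda>a. g (f a)) A"
    using assms(4) by (auto simp: compose_def fun_eq_iff)
  moreover have "restrict f A \<in> A \<rightarrow>\<^sub>E B" "restrict g B \<in> B \<rightarrow>\<^sub>E C" using assms by auto
  ultimately show ?thesis
    using presheaf_comp[OF sym assms(1-3) _ _ assms(6)] unfolding pull_def by metis
qed

lemma res_in: "A \<in> F_obs Pinf \<Longrightarrow> S \<subseteq> A \<Longrightarrow> S \<noteq> {} \<Longrightarrow> x \<in> el M A \<Longrightarrow> res M A S x \<in> el M S"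
  by (rule pull_in) (auto intro: F_obs_Pinf_subset)

lemma res_pull:
  assumes "A \<in> F_obs Pinf" "B \<in> F_obs Pinf" "f \<in> A \<rightarrow> B" "x \<in> el M B" "S \<subseteq> A" "S \<noteq> {}"
  shows "res M A S (pull M A B f x) = pull M S B f x"
  using assms by (intro pull_pull) (auto intro: F_obs_Pinf_subset)

lemma pull_res:
  assumes "A \<in> F_obs Pinf" "B \<in> F_obs Pinf" "S \<subseteq> B" "f \<in> A \<rightarrow> S" "x \<in> el M B"
  shows "pull M A S f (res M B S x) = pull M A B f x"
proof -
  have "S \<noteq> {}" using assms(1,4) by (auto simp: F_obs_Pinf_iff)
  then show ?thesis using assms by (intro pull_pull) (auto intro: F_obs_Pinf_subset)
qed

lemma nondeg_inj_on:
  assumes "A \<in> F_obs Pinf" "B \<in> F_obs Pinf" "g \<in> A \<rightarrow> B" "z \<in> el M B" "S \<subseteq> A" "S \<noteq> {}"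
    and "nondeg M S (res M A S (pull M A B g z))"
  shows "inj_on g S"
  using assms(7) unfolding res_pull[OF assms(1-6)]
  by (rule nondegD) (use assms in auto)

lemma basisD:
  assumes "basis M A x T r" "A \<in> F_obs Pinf" "x \<in> el M A"
  shows "T \<subseteq> A" "T \<noteq> {}" "T \<in> F_obs Pinf" "r \<in> A \<rightarrow> T" "\<And>t. t \<in> T \<Longrightarrow> r t = t"
    "pull M A T r (res M A T x) = x" "nondeg M T (res M A T x)" "res M A T x \<in> el M T" "pull M A A r x = x"
proof -
  show *: "T \<subseteq> A" "T \<noteq> {}" "r \<in> A \<rightarrow> T" "\<And>t. t \<in> T \<Longrightarrow> r t = t"
    "pull M A T r (res M A T x) = x" "nondeg M T (res M A T x)"
    using assms(1) unfolding basis_def by auto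
  show "T \<in> F_obs Pinf" using * assms F_obs_Pinf_subset by blast
  show "res M A T x \<in> el M T" using * assms res_in by blast
  show "pull M A A r x = x" using pull_res[OF assms(2,2) *(1,3) assms(3)] *(5) by simp
qed

text \<open>Take a factorization of \<open>x\<close> whose map has the smallest image and realise
  that image inside \<open>A\<close> by a section; collapsing \<open>T\<close> further would
  contradict minimality.\<close>

lemma basis_exists:
  assumes A: "A \<in> F_obs Pinf" and x: "x \<in> el M A"
  obtains T r where "basis M A x T r"
proof -
  define P where "P n \<longleftrightarrow> (\<exists>K\<in>F_obs Pinf. \<exists>f\<in>A \<rightarrow> K. \<exists>y\<in>el M K. card (f ` A) = n \<and> x = pull M A K f y)" for n
  have "P (card ((\<lambda>a. a) ` A))"
    unfolding P_def
  proof (intro bexI conjI)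
    show "x = pull M A A (\<lambda>a. a) x" by (rule pull_id[symmetric]) (use A x in auto)
  qed (use A x in auto)
  define n where "n = (LEAST n. P n)"
  have "P n" unfolding n_def by (rule LeastI) fact
  have least: "n \<le> m" if "P m" for m unfolding n_def by (rule Least_le) fact
  from \<open>P n\<close> obtain K f y where K: "K \<in> F_obs Pinf" and f: "f \<in> A \<rightarrow> K" and y: "y \<in> el M K"
    and n: "card (f ` A) = n" and xy: "x = pull M A K f y"
    unfolding P_def by blast
  define r where "r a = inv_into A f (f a)" for a
  define T where "T = r ` A"
  have fr: "f (r a) = f a" if "a \<in> A" for a
    unfolding r_def using that by (simp add: f_inv_into_f)
  have rA: "r a \<in> A" if "a \<in> A" for a
    unfolding r_def using that by (simp add: inv_into_into)
  have rr: "r (r a) = r a" if "a \<in> A" for a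
    using fr[OF that] by (simp add: r_def)
  have T: "T \<subseteq> A" "T \<noteq> {}" "r \<in> A \<rightarrow> T" "\<And>t. t \<in> T \<Longrightarrow> r t = t"
    using A rA rr by (auto simp: T_def F_obs_Pinf_iff)
  have TO: "T \<in> F_obs Pinf" using T A F_obs_Pinf_subset by blast
  have cT: "card T = n"
  proof -
    have "T = inv_into A f ` f ` A" by (auto simp: T_def r_def)
    moreover have "inj_on (inv_into A f) (f ` A)" by (simp add: inj_on_inv_into)
    ultimately show ?thesis using n by (simp add: card_image)
  qed
  have xT: "x = pull M A T r (res M A T x)"
  proof -
    have "pull M A T r (res M A T x) = pull M A A r x" using pull_res A T x by blast
    also have "\<dots> = pull M A K (\<lambda>a. f (r a)) y"
      unfolding xy using T by (intro pull_pull A K f y) auto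
    also have "\<dots> = pull M A K f y" by (rule pull_cong) (rule fr)
    finally show ?thesis using xy by simp
  qed
  have "nondeg M T (res M A T x)"
    unfolding nondeg_def
  proof (intro ballI impI)
    fix B g z assume B: "B \<in> F_obs Pinf" and g: "g \<in> T \<rightarrow> B" and z: "z \<in> el M B"
      and eq: "res M A T x = pull M T B g z"
    have "x = pull M A B (\<lambda>a. g (r a)) z"
      using pull_pull[OF A TO B T(3) g z] xT unfolding eq by simp
    moreover have "(\<lambda>a. g (r a)) \<in> A \<rightarrow> B" using T(3) g by auto
    ultimately have "P (card ((\<lambda>a. g (r a)) ` A))" unfolding P_def using B z by blast
    then have "n \<le> card ((\<lambda>a. g (r a)) ` A)" by (rule least)
    also have "(\<lambda>a. g (r a)) ` A = g ` T" by (auto simp: T_def)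
    finally have "card T \<le> card (g ` T)" using cT by simp
    then show "inj_on g T"
      using TO by (metis F_obs_Pinf_iff card_image_le eq_card_imp_inj_on le_antisym)
  qed
  then have "basis M A x T r" unfolding basis_def using T xT[symmetric] by blast
  then show thesis by (rule that)
qed

lemma basis_inj_on:
  assumes "basis M A x T r" "A \<in> F_obs Pinf" "x \<in> el M A" "S \<subseteq> A" "S \<noteq> {}" "nondeg M S (res M A S x)"
  shows "inj_on r S"
  by (rule nondeg_inj_on[of A A r x S]) (use assms(2-) basisD[OF assms(1-3)] in auto)

text \<open>The inverse of \<open>r\<close> on \<open>S\<close> writes the restriction to
  \<open>T\<close> as a pullback of the restriction to \<open>S\<close>, so a collapse of
  \<open>S\<close> would collapse \<open>T\<close>.\<close>

lemma basis_transversal: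
  assumes b: "basis M A x T r" and A: "A \<in> F_obs Pinf" and x: "x \<in> el M A"
    and S: "S \<subseteq> A" and bij: "bij_betw r S T"
  shows "nondeg M S (res M A S x)"
  unfolding nondeg_def
proof (intro ballI impI)
  note D = basisD[OF b A x]
  have S0: "S \<noteq> {}" using bij D(2) by (auto simp: bij_betw_def)
  have SO: "S \<in> F_obs Pinf" using F_obs_Pinf_subset[OF A S S0] .
  define s where "s = inv_into S r"
  have s: "s \<in> T \<rightarrow> S" "\<And>t. t \<in> T \<Longrightarrow> r (s t) = t" "\<And>a. a \<in> S \<Longrightarrow> s (r a) = a"
    using bij_betw_inv_into[OF bij] bij_betw_inv_into_right[OF bij] bij_betw_inv_into_left[OF bij]
    unfolding s_def by (auto simp: bij_betw_def)
  fix B g z assume B: "B \<in> F_obs Pinf" and g: "g \<in> S \<rightarrow> B" and z: "z \<in> el M B"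
    and eq: "res M A S x = pull M S B g z"
  have "res M A T x = pull M T T (\<lambda>t. r (s t)) (res M A T x)"
    by (rule pull_id[symmetric]) (use D(1-5,8) s in auto)
  also have "\<dots> = pull M T A s (pull M A T r (res M A T x))"
    by (rule pull_pull[symmetric]) (use A D(1-5,8) s S in auto)
  also have "\<dots> = pull M T A s x" using D(6) by simp
  also have "\<dots> = pull M T S s (res M A S x)"
    by (rule pull_res[symmetric]) (use A D(1-5,8) s S x in auto)
  also have "\<dots> = pull M T B (\<lambda>t. g (s t)) z"
    unfolding eq by (rule pull_pull) (use D(1-5,8) SO B g z s in auto)
  finally have "inj_on (\<lambda>t. g (s t)) T"
    using D(7) s g B z unfolding nondeg_def by blast
  then show "inj_on g S"
    using bij unfolding inj_on_def bij_betw_def by (metis image_eqI s(3))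
qed

text \<open>\<open>r\<close> embeds into \<open>T\<close> every set on which \<open>x\<close> is
  nondegenerate, so \<open>T\<close> is such a set of largest size.\<close>

lemma basis_card:
  assumes b: "basis M A x T r" and A: "A \<in> F_obs Pinf" and x: "x \<in> el M A"
    and S: "S \<subseteq> A" "S \<noteq> {}" and nd: "nondeg M S (res M A S x)"
  shows "card S \<le> card T" "card T \<le> card S \<Longrightarrow> bij_betw r S T"
proof -
  note D = basisD[OF b A x]
  have inj: "inj_on r S" using basis_inj_on[OF b A x S nd] .
  have fT: "finite T" using D(3) by (simp add: F_obs_Pinf_iff)
  have sub: "r ` S \<subseteq> T" using D(4) S by auto
  show "card S \<le> card T" using card_inj_on_le[OF inj sub fT] .
  show "bij_betw r S T" if "card T \<le> card S"
    unfolding bij_betw_def using inj card_seteq[OF fT sub] that by (simp add: card_image)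
qed

text \<open>The new retraction is \<open>r\<close> followed by the inverse \<open>s\<close> of
  \<open>r\<close> on \<open>S\<close>; it fixes \<open>x\<close> because
  \<open>r s r = r\<close>.\<close>

lemma basis_change:
  assumes b: "basis M A x T r" and A: "A \<in> F_obs Pinf" and x: "x \<in> el M A"
    and S: "S \<subseteq> A" "S \<noteq> {}" and nd: "nondeg M S (res M A S x)" and c: "card T \<le> card S"
  obtains r' where "basis M A x S r'"
proof -
  note D = basisD[OF b A x]
  have SO: "S \<in> F_obs Pinf" using F_obs_Pinf_subset[OF A S] .
  have bij: "bij_betw r S T" using basis_card[OF b A x S nd] c by simp
  define s where "s = inv_into S r"
  have s: "s \<in> T \<rightarrow> S" "\<And>t. t \<in> T \<Longrightarrow> r (s t) = t" "\<And>a. a \<in> S \<Longrightarrow> s (r a) = a"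
    using bij_betw_inv_into[OF bij] bij_betw_inv_into_right[OF bij] bij_betw_inv_into_left[OF bij]
    unfolding s_def by (auto simp: bij_betw_def)
  have sr: "(\<lambda>a. s (r a)) \<in> A \<rightarrow> S" using D(4) s(1) by auto
  have "pull M A S (\<lambda>a. s (r a)) (res M A S x) = pull M A A (\<lambda>a. s (r a)) x"
    by (rule pull_res[OF A A S(1) sr x])
  also have "\<dots> = pull M A A (\<lambda>a. s (r a)) (pull M A T r (res M A T x))" by (simp add: D(6))
  also have "\<dots> = pull M A T (\<lambda>a. r (s (r a))) (res M A T x)"
    by (rule pull_pull) (use A D sr S in auto)
  also have "\<dots> = pull M A T r (res M A T x)"
    by (rule pull_cong) (use s(2) D(4) in auto)
  also have "\<dots> = x" by (rule D(6))
  finally have "pull M A S (\<lambda>a. s (r a)) (res M A S x) = x" .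
  then have "basis M A x S (\<lambda>a. s (r a))"
    unfolding basis_def using sr s(3) S nd by blast
  then show thesis by (rule that)
qed

text \<open>The transversals of a partition determine it.\<close>

lemma basis_retraction_unique:
  assumes bx: "basis M A x T r" and bs: "basis M A y T s"
    and A: "A \<in> F_obs Pinf" and x: "x \<in> el M A" and y: "y \<in> el M A"
    and eq: "\<And>S. S \<subseteq> A \<Longrightarrow> S \<noteq> {} \<Longrightarrow> card S = card T \<Longrightarrow> res M A S x = res M A S y"
    and a: "a \<in> A"
  shows "r a = s a"
proof (rule ccontr)
  assume ne: "r a \<noteq> s a"
  note Dx = basisD[OF bx A x] and Dy = basisD[OF bs A y]
  have fT: "finite T" using Dx(3) by (simp add: F_obs_Pinf_iff)
  have aT: "a \<notin> T" using ne Dx(5) Dy(5) by metis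
  have ra: "r a \<in> T" "s a \<in> T" using a Dx(4) Dy(4) by (auto simp: Pi_iff)
  \<comment> \<open>Exchanging \<open>r a\<close> for \<open>a\<close> gives another transversal for
    \<open>x\<close>, hence a nondegenerate set for \<open>y\<close>; it contains both
    \<open>a\<close> and \<open>s a\<close>, which \<open>s\<close> identifies.\<close>
  define S where "S = insert a (T - {r a})"
  have cS: "card S = card T" unfolding S_def using fT aT ra card_Suc_Diff1[of T "r a"] by simp
  have SA: "S \<subseteq> A" "S \<noteq> {}" using a Dx(1) by (auto simp: S_def)
  have "bij_betw r S T"
  proof (rule bij_betw_imageI)
    have *: "r ` (T - {r a}) = T - {r a}" using Dx(5) by force
    show "r ` S = T" using * ra by (auto simp: S_def)
    show "inj_on r S"
      unfolding S_def inj_on_insert using * Dx(5) by (auto simp: inj_on_def)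
  qed
  then have "nondeg M S (res M A S y)"
    using basis_transversal[OF bx A x SA(1)] eq[OF SA cS] by simp
  then have "inj_on s S" using basis_inj_on[OF bs A y SA] by blast
  moreover have "s a \<in> S" "a \<in> S" "s (s a) = s a" using ra(2) ne Dy(5)[OF ra(2)] by (simp_all add: S_def)
  ultimately have "s a = a" unfolding inj_on_def by blast
  then show False using ra aT by simp
qed

end

subsection \<open>Skeletal symmetric sets\<close>

lemma invertible_iff_bij:
  assumes M: "presheaf C M" and N: "presheaf C N" and t: "natural C M N t"
  shows "invertible C M N t \<longleftrightarrow> (\<forall>A\<in>C. bij_betw (t A) (el M A) (el N A))"
proof
  assume "invertible C M N t"
  then obtain s where s: "natural C N M s" "\<forall>A\<in>C. \<forall>x\<in>el M A. s A (t A x) = x"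
      "\<forall>A\<in>C. \<forall>y\<in>el N A. t A (s A y) = y"
    unfolding invertible_def by blast
  show "\<forall>A\<in>C. bij_betw (t A) (el M A) (el N A)"
  proof
    fix A assume "A \<in> C"
    then show "bij_betw (t A) (el M A) (el N A)"
      using s t unfolding natural_def by (intro bij_betw_byWitness[of _ "s A"]) auto
  qed
next
  assume b: "\<forall>A\<in>C. bij_betw (t A) (el M A) (el N A)"
  define s where "s A = inv_into (el M A) (t A)" for A
  have st: "s A (t A x) = x" if "A \<in> C" "x \<in> el M A" for A x
    using b that unfolding s_def by (auto simp: bij_betw_def)
  have ts: "t A (s A y) = y" and sM: "s A y \<in> el M A" if "A \<in> C" "y \<in> el N A" for A y
    using b that unfolding s_def by (auto simp: bij_betw_def f_inv_into_f inv_into_into)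
  have "s A (act N A B f y) = act M A B f (s B y)"
    if AB: "A \<in> C" "B \<in> C" and f: "f \<in> A \<rightarrow>\<^sub>E B" and y: "y \<in> el N B" for A B f y
  proof -
    have "t A (act M A B f (s B y)) = act N A B f y"
      using t AB f sM[OF AB(2) y] ts[OF AB(2) y] unfolding natural_def by metis
    then show ?thesis using st[OF AB(1) presheaf_act[OF M AB f sM[OF AB(2) y]]] by simp
  qed
  then have "natural C N M s" unfolding natural_def using sM by blast
  then show "invertible C M N t" unfolding invertible_def using t st ts by blast
qed


context symset
begin

lemma natural_restr: "natural (F_obs l) (restr l M) (restr l M) (\<lambda>K x. x)"
  unfolding natural_def by simp

lemma sk_counit_class:
  assumes "A \<in> F_obs Pinf" "K \<in> F_obs l" "f \<in> A \<rightarrow>\<^sub>E K" "y \<in> el M K"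
  shows "sk_counit M A (Lan_eq l (restr l M) A `` {(K, f, y)}) = act M A K f y"
  unfolding sk_counit_def
  using Lan_transpose_class[OF presheaf_restr[OF sym] sym natural_restr assms(1-3)] assms by simp

lemma skeletal_iff_bij:
  "skeletal l M \<longleftrightarrow> (\<forall>A\<in>F_obs Pinf. bij_betw (sk_counit M A) (el (sk l M) A) (el M A))"
  unfolding skeletal_def sk_def sk_counit_def
  by (rule invertible_iff_bij[OF presheaf_Lan[OF presheaf_restr[OF sym]] sym
        Lan_left_adjoint(1)[OF presheaf_restr[OF sym] sym natural_restr]])

lemma coskeletal_iff_bij:
  "coskeletal l M \<longleftrightarrow> (\<forall>A\<in>F_obs Pinf. bij_betw (cosk_unit l M A) (el M A) (el (cosk l M) A))"
  unfolding coskeletal_def cosk_def cosk_unit_def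
  by (rule invertible_iff_bij[OF sym presheaf_Ran Ran_right_adjoint(1)[OF sym natural_restr]])

lemma skeletal_factor:
  assumes "skeletal l M" "A \<in> F_obs Pinf" "x \<in> el M A"
  obtains K f y where "K \<in> F_obs l" "f \<in> A \<rightarrow> K" "y \<in> el M K" "x = pull M A K f y"
proof -
  obtain c where c: "c \<in> el (sk l M) A" "x = sk_counit M A c"
    using assms unfolding skeletal_iff_bij bij_betw_def by blast
  from c(1) obtain K f y where *: "K \<in> F_obs l" "f \<in> A \<rightarrow>\<^sub>E K" "y \<in> el (restr l M) K"
      "c = Lan_eq l (restr l M) A `` {(K, f, y)}"
    unfolding sk_def by (rule el_LanE)
  then have "x = pull M A K f y" using c(2) sk_counit_class[OF assms(2)] by (simp add: pull_act)
  then show thesis using * that[of K f y] by auto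
qed

text \<open>Every representative \<open>(K, f, y)\<close> of \<open>x\<close> is identified with the one given by a basis of
  \<open>x\<close>, so the counit of \<open>sk\<close> is always injective.\<close>

lemma Lan_eq_basis:
  assumes A: "A \<in> F_obs Pinf" and K: "K \<in> F_obs (Fin n)" and f: "f \<in> A \<rightarrow>\<^sub>E K" and y: "y \<in> el M K"
    and x: "x = act M A K f y" and b: "basis M A x T r"
  shows "T \<in> F_obs (Fin n)"
    "Lan_eq (Fin n) (restr (Fin n) M) A `` {(K, f, y)} = Lan_eq (Fin n) (restr (Fin n) M) A `` {(T, restrict r A, res M A T x)}"
proof -
  let ?X = "restr (Fin n) M"
  let ?c = "\<lambda>K f y. Lan_eq (Fin n) ?X A `` {(K, f, y)}"
  have X: "presheaf (F_obs (Fin n)) ?X" by (rule presheaf_restr[OF sym])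
  \<comment> \<open>The coend relation in usable form: \<open>h\<close> is shifted from the element
    to the map out of \<open>A\<close>.\<close>
  have move: "?c K f (pull M K L h y) = ?c L (restrict (\<lambda>a. h (f a)) A) y"
    if "K \<in> F_obs (Fin n)" "L \<in> F_obs (Fin n)" "f \<in> A \<rightarrow>\<^sub>E K" "h \<in> K \<rightarrow> L" "y \<in> el M L" for K L f h y
  proof -
    have "Lan_step (Fin n) ?X A (K, f, act ?X K L (restrict h K) y) (L, compose A (restrict h K) f, y)"
      unfolding Lan_step_def using that
      by (intro bexI[of _ K] bexI[of _ L] bexI[of _ f] bexI[of _ "restrict h K"] bexI[of _ y]) simp_all
    moreover have "compose A (restrict h K) f = restrict (\<lambda>a. h (f a)) A"
      using that(3) by (auto simp: compose_def fun_eq_iff)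
    ultimately show ?thesis
      using equiv_class_eq[OF equiv_Lan_eq Lan_step_eq[OF X]] that(1,2) by (simp add: pull_def)
  qed
  have KO: "K \<in> F_obs Pinf" using K F_obs_Pinf by blast
  have fA: "f \<in> A \<rightarrow> K" using f by auto
  have xp: "x = pull M A K f y" using x f by (simp add: pull_act)
  have xA: "x \<in> el M A" unfolding xp by (rule pull_in) (use A KO fA y in auto)
  note D = basisD[OF b A xA]
  let ?z = "res M A T x"
  have zp: "?z = pull M T K f y" unfolding xp using res_pull[OF A KO fA y D(1,2)] .
  have inj: "inj_on f T" using D(7) unfolding zp by (rule nondegD) (use KO fA y D(1) in auto)
  have "card T \<le> card K"
    using inj fA D(1) KO by (intro card_inj_on_le[of f T K]) (auto simp: F_obs_Pinf_iff)
  then show TO: "T \<in> F_obs (Fin n)" using K D(3) by (auto simp: F_obs_Fin_iff F_obs_Pinf_iff)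
  \<comment> \<open>Passing to the image makes \<open>f\<close> surjective, so that it has a
    section.\<close>
  define L where "L = f ` A"
  have L: "L \<subseteq> K" "L \<noteq> {}" using fA A by (auto simp: L_def F_obs_Pinf_iff)
  have LO: "L \<in> F_obs Pinf" using F_obs_Pinf_subset[OF KO L] .
  have LF: "L \<in> F_obs (Fin n)"
    using K L card_mono[of K L] by (auto simp: F_obs_Fin_iff intro: finite_subset)
  have fL: "f \<in> A \<rightarrow>\<^sub>E L" using f by (auto simp: L_def)
  \<comment> \<open>A section of \<open>f\<close> that sends \<open>f ` T\<close> back to \<open>T\<close>, so that \<open>r s f\<close> fixes \<open>T\<close>.\<close>
  define s where "s k = (if k \<in> f ` T then inv_into T f k else inv_into A f k)" for k
  have s: "s \<in> L \<rightarrow> A" "\<And>k. k \<in> L \<Longrightarrow> f (s k) = k"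
    unfolding s_def L_def using D(1) by (auto simp: f_inv_into_f inv_into_into) (meson inv_into_into image_eqI subsetD)
  have sT: "s (f t) = t" if "t \<in> T" for t
    unfolding s_def using that inj by simp
  have rs: "(\<lambda>k. r (s k)) \<in> L \<rightarrow> T" using s D(4) by auto
  have "res M K L y = pull M L K (\<lambda>k. f (s k)) y"
    using s by (intro pull_cong) auto
  also have "\<dots> = pull M L A s x"
    unfolding xp by (rule pull_pull[symmetric]) (use A KO LO fA s y in auto)
  also have "\<dots> = pull M L A s (pull M A T r ?z)" using D(6) by simp
  also have "\<dots> = pull M L T (\<lambda>k. r (s k)) ?z"
    by (rule pull_pull) (use A LO s D in auto)
  finally have yL: "res M K L y = pull M L T (\<lambda>k. r (s k)) ?z" .
  have fr: "restrict f A = f" using f by (simp add: PiE_restrict)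
  have "?c K f y = ?c L f (res M K L y)"
    using move[OF LF K fL, of "\<lambda>k. k" y] L y fr by auto
  also have "\<dots> = ?c T (restrict (\<lambda>a. r (s (f a))) A) ?z"
    unfolding yL by (rule move[OF LF TO fL rs D(8)])
  \<comment> \<open>Both retractions onto \<open>T\<close> exhibit the same \<open>x\<close>, which
    determines the retraction.\<close>
  also have "restrict (\<lambda>a. r (s (f a))) A = restrict r A"
  proof (rule restrict_ext)
    fix a assume a: "a \<in> A"
    have "pull M A T (\<lambda>a. r (s (f a))) ?z = pull M A L f (pull M L T (\<lambda>k. r (s k)) ?z)"
      by (rule pull_pull[symmetric]) (use A LO rs fL D in auto)
    also have "\<dots> = pull M A L f (res M K L y)" using yL by simp
    also have "\<dots> = x" unfolding xp by (rule pull_res) (use A KO L fL y in auto)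
    finally have "basis M A x T (\<lambda>a. r (s (f a)))"
      unfolding basis_def using D(1,2,5,7) rs fL sT by auto
    then show "r (s (f a)) = r a"
      using basis_retraction_unique[OF _ b A xA xA _ a] by blast
  qed
  finally show "?c K f y = ?c T (restrict r A) ?z" .
qed

text \<open>The hypothesis is surjectivity of the counit; injectivity follows by moving two
  representatives of one element to the one built from a basis.\<close>

lemma skeletalI:
  assumes fac: "\<And>A x. A \<in> F_obs Pinf \<Longrightarrow> x \<in> el M A \<Longrightarrow>
    \<exists>K\<in>F_obs (Fin n). \<exists>f\<in>A \<rightarrow> K. \<exists>y\<in>el M K. x = pull M A K f y"
  shows "skeletal (Fin n) M"
  unfolding skeletal_iff_bij
proof
  fix A assume A: "A \<in> F_obs Pinf"
  show "bij_betw (sk_counit M A) (el (sk (Fin n) M) A) (el M A)"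
  proof (rule bij_betw_imageI)
    show "inj_on (sk_counit M A) (el (sk (Fin n) M) A)"
    proof (rule inj_onI)
      fix c d assume "c \<in> el (sk (Fin n) M) A" "d \<in> el (sk (Fin n) M) A"
        and eq: "sk_counit M A c = sk_counit M A d"
      then obtain K f y L g z where c: "K \<in> F_obs (Fin n)" "f \<in> A \<rightarrow>\<^sub>E K" "y \<in> el M K"
          "c = Lan_eq (Fin n) (restr (Fin n) M) A `` {(K, f, y)}"
        and d: "L \<in> F_obs (Fin n)" "g \<in> A \<rightarrow>\<^sub>E L" "z \<in> el M L"
          "d = Lan_eq (Fin n) (restr (Fin n) M) A `` {(L, g, z)}"
        unfolding sk_def by (elim el_LanE) auto
      define x where "x = act M A K f y"
      have x': "x = act M A L g z"
        using eq c d sk_counit_class[OF A] unfolding x_def by simp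
      have "x \<in> el M A" unfolding x_def using presheaf_act[OF sym A F_obs_Pinf c(2)] c by blast
      then obtain T r where b: "basis M A x T r" using basis_exists[OF A] by blast
      show "c = d"
        unfolding c(4) d(4) using Lan_eq_basis(2)[OF A c(1-3) x_def b] Lan_eq_basis(2)[OF A d(1-3) x' b] by simp
    qed
    show "sk_counit M A ` el (sk (Fin n) M) A = el M A"
    proof
      show "sk_counit M A ` el (sk (Fin n) M) A \<subseteq> el M A"
      proof
        fix x assume "x \<in> sk_counit M A ` el (sk (Fin n) M) A"
        then obtain K f y where "K \<in> F_obs (Fin n)" "f \<in> A \<rightarrow>\<^sub>E K" "y \<in> el M K" "x = act M A K f y"
          unfolding sk_def by (auto elim!: el_LanE simp: sk_counit_class[OF A])
        then show "x \<in> el M A" using presheaf_act[OF sym A F_obs_Pinf] by blast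
      qed
      show "el M A \<subseteq> sk_counit M A ` el (sk (Fin n) M) A"
      proof
        fix x assume "x \<in> el M A"
        then obtain K f y where *: "K \<in> F_obs (Fin n)" "f \<in> A \<rightarrow> K" "y \<in> el M K" "x = pull M A K f y"
          using fac[OF A] by blast
        let ?c = "Lan_eq (Fin n) (restr (Fin n) M) A `` {(K, restrict f A, y)}"
        have "?c \<in> el (sk (Fin n) M) A"
          unfolding sk_def by (rule el_LanI) (use * in auto)
        moreover have "sk_counit M A ?c = x"
          using sk_counit_class[OF A *(1) _ *(3), of "restrict f A"] * by (auto simp: pull_def)
        ultimately show "x \<in> sk_counit M A ` el (sk (Fin n) M) A" by blast
      qed
    qed
  qed
qed

end

subsection \<open>Fillers of spheres\<close>

text \<open>Deleting any point outside an edge leaves a complete \<open>(l + 1)\<close>-partite hypergraph; \<open>b\<close> lies in the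
  block of \<open>a\<close> with respect to \<open>T\<close>.\<close>

lemma no_edges_meeting_in_one_point:
  fixes A :: "'b set" and G :: "'b set \<Rightarrow> bool"
  assumes A: "finite A" "card A = 2 * l + 1" and l: "3 \<le> l"
    and G: "\<And>T. G T \<Longrightarrow> T \<subseteq> A \<and> card T = l + 1"
    and part: "\<And>T d. G T \<Longrightarrow> d \<in> A - T \<Longrightarrow>
      \<exists>r. r \<in> A - {d} \<rightarrow> T \<and> (\<forall>t\<in>T. r t = t) \<and>
        (\<forall>S. S \<subseteq> A - {d} \<and> card S = l + 1 \<longrightarrow> (G S \<longleftrightarrow> inj_on r S))"
    and T: "G T" and a: "a \<in> T" and T2: "G (insert a (A - T))"
    and b: "b \<in> A - T" and ab: "G (insert b (T - {a}))"
  shows False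
proof -
  \<comment> \<open>\<open>r u\<close> is the only point of \<open>B\<close> that \<open>u\<close>
    can replace in this edge. This describes \<open>r u\<close> by \<open>G\<close> alone,
    independently of the deleted point \<open>d\<close>.\<close>
  have ret: "\<exists>r. r \<in> A - {d} \<rightarrow> B \<and> (\<forall>t\<in>B. r t = t) \<and> (\<forall>S. S \<subseteq> A - {d} \<longrightarrow> G S \<longrightarrow> inj_on r S)
      \<and> (\<forall>u t. t \<in> B \<longrightarrow> u \<in> A - B - {d} \<longrightarrow> G (insert u (B - {t})) \<longrightarrow> r u = t)
      \<and> (\<forall>u. u \<in> A - B - {d} \<longrightarrow> G (insert u (B - {r u})))"
    if B: "G B" and d: "d \<in> A - B" for B d
  proof -
    from part[OF that] obtain r where R: "r \<in> A - {d} \<rightarrow> B \<and> (\<forall>t\<in>B. r t = t) \<and>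
        (\<forall>S. S \<subseteq> A - {d} \<and> card S = l + 1 \<longrightarrow> (G S \<longleftrightarrow> inj_on r S))"
      by (rule exE)
    from R have r: "r \<in> A - {d} \<rightarrow> B" "\<And>t. t \<in> B \<Longrightarrow> r t = t"
      and rG: "\<And>S. S \<subseteq> A - {d} \<Longrightarrow> card S = l + 1 \<Longrightarrow> G S \<longleftrightarrow> inj_on r S"
      by simp_all
    have BA: "B \<subseteq> A" "card B = l + 1" "finite B"
      using G[OF B] finite_subset[of B A] A(1) by simp_all
    have inj: "inj_on r S" if "S \<subseteq> A - {d}" "G S" for S using rG[OF that(1)] G[OF that(2)] that(2) by simp
    have val: "r u = t" if "t \<in> B" "u \<in> A - B - {d}" "G (insert u (B - {t}))" for u t
    proof (rule ccontr)
      assume ne: "r u \<noteq> t"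
      have "inj_on r (insert u (B - {t}))" using that BA d by (intro inj) auto
      moreover have "r u \<in> B" using r that by auto
      ultimately have "r u = u"
        using r(2)[of "r u"] ne unfolding inj_on_def by blast
      then show False using \<open>r u \<in> B\<close> that by simp
    qed
    have ex: "G (insert u (B - {r u}))" if u: "u \<in> A - B - {d}" for u
    proof -
      have ru: "r u \<in> B" using r u by auto
      have im: "r ` (B - {r u}) = B - {r u}" using r(2) by force
      have "inj_on r (insert u (B - {r u}))"
        unfolding inj_on_insert using im r(2) by (auto simp: inj_on_def)
      moreover have "card (insert u (B - {r u})) = l + 1"
        using u ru BA card_Suc_Diff1[OF BA(3) ru] by simp
      moreover have "insert u (B - {r u}) \<subseteq> A - {d}" using u BA d by auto
      ultimately show ?thesis using rG by simp
    qed
    show ?thesis by (intro exI[of _ r] conjI r(1)) (simp_all add: r(2) inj val ex)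
  qed
  let ?U = "A - T"
  let ?T2 = "insert a ?U"
  have TA: "T \<subseteq> A" "card T = l + 1" "finite T"
    using G[OF T] finite_subset[of T A] A(1) by simp_all
  have cU: "card ?U = l" using A TA by (simp add: card_Diff_subset)
  have U2: "A - ?T2 = T - {a}" using TA by auto
  have cU2: "card (T - {a}) = l" using TA a by simp
  have two: "\<exists>v\<in>V. v \<noteq> u" if "2 \<le> card V" for V and u :: 'b
  proof (rule ccontr)
    assume "\<not> ?thesis"
    then have "V \<subseteq> {u}" by blast
    then show False using that card_mono[of "{u}" V] by auto
  qed
  have exch: "\<exists>t\<in>B. G (insert u (B - {t}))" if B: "G B" "u \<in> A - B" "2 \<le> card (A - B)" for B u
  proof -
    from two[OF B(3)] obtain d where "d \<in> A - B" "d \<noteq> u" by blast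
    with ret[OF B(1) this(1)] B(2) show ?thesis by (metis DiffI Diff_iff Pi_mem empty_iff insert_iff)
  qed
  \<comment> \<open>If \<open>e\<close> replaced some other \<open>t\<close> in the edge
    \<open>?T2\<close>, then deleting \<open>t\<close> would leave \<open>a\<close> and
    \<open>b\<close> in one block relative to \<open>T\<close>, although both lie on the new
    edge.\<close>
  have c1: "t = a \<or> t = b" if e: "e \<in> T - {a}" and t: "t \<in> ?T2" and Gt: "G (insert e (?T2 - {t}))" for e t
  proof (rule ccontr)
    assume ne: "\<not> ?thesis"
    then have "t \<in> A - T" using t by auto
    from ret[OF T this] obtain r where r: "\<forall>t\<in>T. r t = t" "\<forall>S. S \<subseteq> A - {t} \<longrightarrow> G S \<longrightarrow> inj_on r S"
      "\<forall>u s. s \<in> T \<longrightarrow> u \<in> A - T - {t} \<longrightarrow> G (insert u (T - {s})) \<longrightarrow> r u = s" by blast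
    have "r b = a" by (rule r(3)[rule_format, OF a _ ab]) (use b ne in auto)
    moreover have ij: "inj_on r (insert e (?T2 - {t}))"
      by (rule r(2)[rule_format, OF _ Gt]) (use e TA(1) a \<open>t \<in> A - T\<close> in auto)
    moreover have "r a = a" using r(1) a by blast
    ultimately have "b = a" using ne b inj_onD[OF ij, of b a] by auto
    then show False using a b by simp
  qed
  \<comment> \<open>If \<open>u\<close> replaced \<open>c\<close> in \<open>T\<close>, then after
    deleting \<open>c\<close> the retraction onto \<open>?T2\<close> would send all of
    \<open>T - {a} - {c}\<close> to \<open>b\<close> by \<open>c1\<close>. This set has two points
    by \<open>3 \<le> l\<close>, yet the retraction is injective on the new edge.\<close>
  have c2: False if u: "u \<in> ?U" and c: "c \<in> T - {a}" and Gc: "G (insert u (T - {c}))" for u c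
  proof -
    have "c \<in> A - ?T2" using c U2 by simp
    from ret[OF T2 this] obtain r where r: "r \<in> A - {c} \<rightarrow> ?T2" "\<forall>t\<in>?T2. r t = t"
      "\<forall>S. S \<subseteq> A - {c} \<longrightarrow> G S \<longrightarrow> inj_on r S"
      "\<forall>u. u \<in> A - ?T2 - {c} \<longrightarrow> G (insert u (?T2 - {r u}))" by blast
    have inj: "inj_on r (insert u (T - {c}))"
      by (rule r(3)[rule_format, OF _ Gc]) (use u c TA(1) in auto)
    have rb: "r e = b" if e: "e \<in> T - {a} - {c}" for e
    proof -
      have eA: "e \<in> A - ?T2 - {c}" using e U2 by simp
      have "r e = a \<or> r e = b"
      proof (rule c1)
        show "e \<in> T - {a}" using e by simp
        show "r e \<in> ?T2" using eA r(1) by (auto simp only: Pi_iff)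
        show "G (insert e (?T2 - {r e}))" using r(4) eA by blast
      qed
      moreover have "r e \<noteq> r a" using inj_onD[OF inj, of e a] e a c by auto
      ultimately show ?thesis using r(2) by auto
    qed
    have "card (T - {a} - {c}) \<ge> 2" using cU2 c l TA(3) by simp
    then obtain e e' where ee: "e \<in> T - {a} - {c}" "e' \<in> T - {a} - {c}" "e \<noteq> e'"
      using two[of "T - {a} - {c}"] by blast
    then show False using inj_onD[OF inj, of e e'] rb[OF ee(1)] rb[OF ee(2)] by simp
  qed
  have c3: "G (insert u (T - {a}))" if u: "u \<in> ?U" for u
    using exch[OF T u] c2[OF u] cU l by auto
  \<comment> \<open>By \<open>c3\<close> a second point \<open>u\<close> of \<open>?U\<close> shares
    the block of \<open>a\<close> when \<open>b\<close> is deleted, but the new edge would contain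
    both.\<close>
  have c4: False if e: "e \<in> T - {a}" and Ge: "G (insert e (?T2 - {b}))" for e
  proof -
    obtain u where u: "u \<in> ?U" "u \<noteq> b" using two[of ?U b] cU l by auto
    from ret[OF T b] obtain r where r: "\<forall>t\<in>T. r t = t" "\<forall>S. S \<subseteq> A - {b} \<longrightarrow> G S \<longrightarrow> inj_on r S"
      "\<forall>u s. s \<in> T \<longrightarrow> u \<in> A - T - {b} \<longrightarrow> G (insert u (T - {s})) \<longrightarrow> r u = s" by blast
    have "r u = a" by (rule r(3)[rule_format, OF a _ c3]) (use u in auto)
    moreover have ij: "inj_on r (insert e (?T2 - {b}))"
      by (rule r(2)[rule_format, OF _ Ge]) (use e TA(1) a b in auto)
    moreover have "r a = a" using r(1) a by blast
    ultimately have "u = a" using u a b inj_onD[OF ij, of u a] by auto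
    then show False using a u by simp
  qed
  have c5: "G (insert e ?U)" if e: "e \<in> T - {a}" for e
  proof -
    have "e \<in> A - ?T2" using e U2 by simp
    moreover have "2 \<le> card (A - ?T2)" unfolding U2 cU2 using l by simp
    ultimately obtain t where t: "t \<in> ?T2" "G (insert e (?T2 - {t}))"
      using exch[OF T2] by blast
    then have "t = a" using c1[OF e t] c4[OF e] by auto
    then show ?thesis using t(2) a by simp
  qed
  obtain e where e: "e \<in> T - {a}" using two[of "T - {a}" a] cU2 l by auto
  obtain u where u: "u \<in> ?U" "u \<noteq> b" using two[of ?U b] cU l by auto
  \<comment> \<open>With \<open>a\<close> deleted, \<open>b\<close> and \<open>u\<close> share a
    block relative to the edge \<open>B\<close>, while by \<open>c5\<close> both lie on the edge
    \<open>insert e ?U\<close>.\<close>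
  define B where "B = insert u (T - {a})"
  have GB: "G B" using c3[OF u(1)] by (simp add: B_def)
  have "a \<in> A - B" using a u TA by (auto simp: B_def)
  from ret[OF GB this] obtain r where r: "\<forall>t\<in>B. r t = t"
    "\<forall>S. S \<subseteq> A - {a} \<longrightarrow> G S \<longrightarrow> inj_on r S"
    "\<forall>v s. s \<in> B \<longrightarrow> v \<in> A - B - {a} \<longrightarrow> G (insert v (B - {s})) \<longrightarrow> r v = s" by blast
  have "B - {u} = T - {a}" using u by (auto simp: B_def)
  then have "G (insert b (B - {u}))" using ab by simp
  then have "r b = u" by (rule r(3)[rule_format, rotated 2]) (use b u a in \<open>auto simp: B_def\<close>)
  moreover have ij: "inj_on r (insert e ?U)" by (rule r(2)[rule_format, OF _ c5[OF e]]) (use e a TA in auto)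
  moreover have "r u = u" using r(1) by (simp add: B_def)
  ultimately have "b = u" using u b inj_onD[OF ij, of b u] by auto
  then show False using u by simp
qed

text \<open>A morphism from the boundary of the representable \<open>F(-, A)\<close> to \<open>M\<close>.\<close>

definition sphere :: "'a psh \<Rightarrow> nat set \<Rightarrow> (nat set \<Rightarrow> 'a) \<Rightarrow> bool" where
  "sphere M A X \<longleftrightarrow> (\<forall>S. S \<noteq> {} \<longrightarrow> S \<subset> A \<longrightarrow> X S \<in> el M S) \<and>
     (\<forall>S S'. S \<noteq> {} \<longrightarrow> S \<subseteq> S' \<longrightarrow> S' \<subset> A \<longrightarrow> res M S' S (X S') = X S)"

definition filler :: "'a psh \<Rightarrow> nat set \<Rightarrow> (nat set \<Rightarrow> 'a) \<Rightarrow> 'a \<Rightarrow> bool" where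
  "filler M A X x \<longleftrightarrow> x \<in> el M A \<and> (\<forall>S. S \<noteq> {} \<longrightarrow> S \<subset> A \<longrightarrow> res M A S x = X S)"

context symset
begin

section \<open>Elements of a skeletal symmetric set are determined by small restrictions\<close>

lemma res_res:
  assumes "A \<in> F_obs Pinf" "x \<in> el M A" "S \<subseteq> A" "S \<noteq> {}" "V \<subseteq> S" "V \<noteq> {}"
  shows "res M S V (res M A S x) = res M A V x"
proof -
  have "S \<in> F_obs Pinf" "V \<in> F_obs Pinf" using assms F_obs_Pinf_subset by (blast, metis subset_trans)
  then show ?thesis using assms by (intro pull_res) auto
qed

lemma nondeg_card_le:
  assumes sk: "skeletal (Fin l) M" and S: "S \<in> F_obs Pinf" and y: "y \<in> el M S" and nd: "nondeg M S y"
  shows "card S \<le> l + 1"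
proof -
  obtain K f z where K: "K \<in> F_obs (Fin l)" "f \<in> S \<rightarrow> K" "z \<in> el M K" "y = pull M S K f z"
    using skeletal_factor[OF sk S y] .
  have "inj_on f S" by (rule nondegD[of M S K f z]) (use nd K F_obs_Pinf in auto)
  then have "card S \<le> card K"
    using K by (intro card_inj_on_le[of f S K]) (auto simp: F_obs_Fin_iff)
  then show ?thesis using K(1) by (simp add: F_obs_Fin_iff)
qed

lemma basis_card_le:
  assumes "skeletal (Fin l) M" "A \<in> F_obs Pinf" "x \<in> el M A" "basis M A x T r"
  shows "card T \<le> l + 1"
  by (rule nondeg_card_le[OF assms(1) basisD(3,8,7)[OF assms(4,2,3)]])

text \<open>Bases have at most \<open>l + 1\<close> points, so \<open>eq\<close> reaches every set
  needed to compare the decompositions. Hence \<open>x\<close> and \<open>y\<close> share a basis,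
  the retraction onto it and the restriction to it.\<close>

lemma eq_if_small_restrictions_eq:
  assumes sk: "skeletal (Fin l) M" and A: "A \<in> F_obs Pinf" and x: "x \<in> el M A" and y: "y \<in> el M A"
    and eq: "\<And>S. S \<subseteq> A \<Longrightarrow> S \<noteq> {} \<Longrightarrow> card S \<le> l + 1 \<Longrightarrow> res M A S x = res M A S y"
  shows "x = y"
proof -
  obtain T r where bx: "basis M A x T r" using basis_exists[OF A x] .
  obtain T' r' where bs': "basis M A y T' r'" using basis_exists[OF A y] .
  note Dx = basisD[OF bx A x] and Dy = basisD[OF bs' A y]
  have c: "card T \<le> l + 1" "card T' \<le> l + 1"
    using basis_card_le[OF sk A x bx] basis_card_le[OF sk A y bs'] by auto
  have ndT: "nondeg M T (res M A T y)" using Dx(7) eq[OF Dx(1,2) c(1)] by simp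
  have ndT': "nondeg M T' (res M A T' x)" using Dy(7) eq[OF Dy(1,2) c(2)] by simp
  have "card T' \<le> card T" using basis_card(1)[OF bx A x Dy(1,2) ndT'] .
  then obtain s where bs: "basis M A y T s" using basis_change[OF bs' A y Dx(1,2) ndT] by blast
  have "r a = s a" if "a \<in> A" for a
    by (rule basis_retraction_unique[OF bx bs A x y eq that]) (use c in auto)
  then have "pull M A T r (res M A T x) = pull M A T s (res M A T y)"
    using eq[OF Dx(1,2) c(1)] by (metis pull_cong)
  then show "x = y" using Dx(6) basisD(6)[OF bs A y] by simp
qed

lemma nondeg_singleton:
  assumes "S = {s}" shows "nondeg M S y"
  unfolding nondeg_def assms by simp

text \<open>The filler is the face opposite \<open>b\<close>, pulled back along the map sending
  \<open>b\<close> to \<open>a\<close>. The face opposite \<open>a\<close> is not covered by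
  \<open>inv\<close>; it has more than \<open>l + 1\<close> points, so each small subset of it
  misses a further point and lies in a face already treated.\<close>

lemma sphere_filler_of_pair:
  assumes sk: "skeletal (Fin l) M" and A: "A \<in> F_obs Pinf" and cA: "l + 3 \<le> card A"
    and X: "sphere M A X" and ab: "a \<in> A" "b \<in> A" "a \<noteq> b"
    and inv: "\<And>c. c \<in> A - {a, b} \<Longrightarrow>
      pull M (A - {c}) (A - {c}) (\<lambda>v. if v = b then a else v) (X (A - {c})) = X (A - {c})"
  shows "\<exists>x. filler M A X x"
proof -
  let ?e = "\<lambda>v. if v = b then a else v"
  have fA: "finite A" using A by (simp add: F_obs_Pinf_iff)
  have XS: "X S \<in> el M S" if "S \<noteq> {}" "S \<subset> A" for S using X that unfolding sphere_def by blast
  have rX: "res M S' S (X S') = X S" if "S \<noteq> {}" "S \<subseteq> S'" "S' \<subset> A" for S S'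
    using X that unfolding sphere_def by blast
  have Ob: "S \<in> F_obs Pinf" if "S \<noteq> {}" "S \<subseteq> A" for S using F_obs_Pinf_subset[OF A] that by blast
  have ne: "A - {c} - {d} \<noteq> {}" for c d
  proof
    assume "A - {c} - {d} = {}"
    then have "card A \<le> card {c, d}" by (intro card_mono) auto
    also have "\<dots> \<le> 2" by (simp add: card_insert_if)
    finally show False using cA by simp
  qed
  have ne1: "A - {c} \<noteq> {}" for c using ne[of c c] by blast
  define x where "x = pull M A (A - {b}) ?e (X (A - {b}))"
  have eA: "?e \<in> A \<rightarrow> A - {b}" using ab by auto
  have Ob1: "A - {c} \<in> F_obs Pinf" for c using Ob[OF ne1] by auto
  have Xb: "X (A - {c}) \<in> el M (A - {c})" if "c \<in> A" for c using XS[OF ne1] that by blast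
  have xA: "x \<in> el M A" unfolding x_def by (rule pull_in[OF A Ob1 eA Xb]) (use ab in auto)
  have rx: "res M A (A - {c}) x = pull M (A - {c}) (A - {b}) ?e (X (A - {b}))" for c
    unfolding x_def by (rule res_pull[OF A Ob1 eA Xb]) (use ab ne1 in auto)
  have face: "res M A (A - {c}) x = X (A - {c})" if c: "c \<in> A" "c \<noteq> a" for c
  proof (cases "c = b")
    case True
    have "pull M (A - {b}) (A - {b}) ?e (X (A - {b})) = X (A - {b})"
      by (rule pull_id[OF Ob1 Xb]) (use ab in auto)
    then show ?thesis using rx True by simp
  next
    case False
    let ?V = "A - {c} - {b}"
    have V: "?V \<noteq> {}" "?V \<subseteq> A - {b}" "?V \<subseteq> A - {c}" "?V \<in> F_obs Pinf"
      using ne Ob[OF ne] by auto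
    have eV: "?e \<in> A - {c} \<rightarrow> ?V" using ab c by auto
    have "pull M (A - {c}) (A - {b}) ?e (X (A - {b})) = pull M (A - {c}) ?V ?e (res M (A - {b}) ?V (X (A - {b})))"
      by (rule pull_res[OF Ob1 Ob1 V(2) eV Xb, symmetric]) (use ab in auto)
    also have "res M (A - {b}) ?V (X (A - {b})) = X ?V" by (rule rX) (use V ab in auto)
    also have "X ?V = res M (A - {c}) ?V (X (A - {c}))" by (rule rX[symmetric]) (use V c in auto)
    also have "pull M (A - {c}) ?V ?e (res M (A - {c}) ?V (X (A - {c})))
        = pull M (A - {c}) (A - {c}) ?e (X (A - {c}))"
      by (rule pull_res[OF Ob1 Ob1 V(3) eV Xb]) (use c in auto)
    also have "\<dots> = X (A - {c})" by (rule inv) (use c False in auto)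
    finally show ?thesis using rx by simp
  qed
  have sub: "res M A S x = X S" if S: "S \<noteq> {}" "S \<subset> A" "c \<in> A" "c \<noteq> a" "c \<notin> S" for S c
  proof -
    have "res M A S x = res M (A - {c}) S (res M A (A - {c}) x)"
      by (rule res_res[symmetric]) (use A xA S ne1 in auto)
    then show ?thesis using rX[of S "A - {c}"] face S by auto
  qed
  have "res M A (A - {a}) x = X (A - {a})"
  proof (rule eq_if_small_restrictions_eq[OF sk Ob1])
    show "res M A (A - {a}) x \<in> el M (A - {a})" by (rule res_in) (use A ne1 xA in auto)
    show "X (A - {a}) \<in> el M (A - {a})" by (rule Xb) (rule ab)
    fix S assume S: "S \<subseteq> A - {a}" "S \<noteq> {}" "card S \<le> l + 1"
    have "S \<noteq> A - {a}" using S(3) cA fA ab by auto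
    then obtain c where c: "c \<in> A" "c \<noteq> a" "c \<notin> S" using S(1) by blast
    have "res M (A - {a}) S (res M A (A - {a}) x) = res M A S x"
      by (rule res_res) (use A xA S ne1 in auto)
    also have "\<dots> = X S" by (rule sub[OF S(2) _ c]) (use S ab in auto)
    also have "\<dots> = res M (A - {a}) S (X (A - {a}))" by (rule rX[symmetric]) (use S ab in auto)
    finally show "res M (A - {a}) S (res M A (A - {a}) x) = res M (A - {a}) S (X (A - {a}))" .
  qed
  then have face': "res M A (A - {c}) x = X (A - {c})" if "c \<in> A" for c
    using face[OF that] by blast
  have "res M A S x = X S" if S: "S \<noteq> {}" "S \<subset> A" for S
  proof -
    from S obtain c where c: "c \<in> A" "c \<notin> S" by blast
    have "res M A S x = res M (A - {c}) S (res M A (A - {c}) x)"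
      by (rule res_res[symmetric]) (use A xA S c ne1 in auto)
    then show ?thesis using rX[of S "A - {c}"] face'[OF c(1)] S c by auto
  qed
  then show ?thesis unfolding filler_def using xA by blast
qed

lemma sphere_has_filler:
  assumes sk: "skeletal (Fin l) M" and A: "A \<in> F_obs Pinf" and cA: "l + 3 \<le> card A"
    and cA': "2 * l + 2 \<le> card A \<or> 3 \<le> l \<and> card A = 2 * l + 1"
    and X: "sphere M A X"
  shows "\<exists>x. filler M A X x"
proof -
  have fA: "finite A" using A by (simp add: F_obs_Pinf_iff)
  have XS: "X S \<in> el M S" if "S \<noteq> {}" "S \<subset> A" for S using X that unfolding sphere_def by blast
  have rX: "res M S' S (X S') = X S" if "S \<noteq> {}" "S \<subseteq> S'" "S' \<subset> A" for S S'
    using X that unfolding sphere_def by blast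
  have Ob: "S \<in> F_obs Pinf" if "S \<noteq> {}" "S \<subseteq> A" for S using F_obs_Pinf_subset[OF A] that by blast
  define ND where "ND S \<longleftrightarrow> S \<noteq> {} \<and> S \<subset> A \<and> nondeg M S (X S)" for S
  have ND_le: "card S \<le> l + 1" if "ND S" for S
    using nondeg_card_le[OF sk Ob XS] that unfolding ND_def by blast
  have "\<exists>S. ND S"
  proof -
    obtain v where v: "v \<in> A" using A by (auto simp: F_obs_Pinf_iff)
    have "{v} \<noteq> A" using cA by auto
    then have "ND {v}" unfolding ND_def using v nondeg_singleton by blast
    then show ?thesis ..
  qed
  then obtain S0 where "ND S0" ..
  then have "\<exists>T. ND T \<and> (\<forall>S. ND S \<longrightarrow> card S \<le> card T)"
    by (rule ex_has_greatest_nat[where b = "l + 2"]) (use ND_le in \<open>simp add: less_Suc_eq_le\<close>)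
  then obtain T where T: "ND T" and Tmax: "\<And>S. ND S \<Longrightarrow> card S \<le> card T" by blast
  have TA: "T \<noteq> {}" "T \<subset> A" "nondeg M T (X T)" "finite T" "card T \<le> l + 1"
    using T[unfolded ND_def] finite_subset[of T A] fA ND_le[OF T] by (auto simp: psubset_imp_subset)
  have resd: "res M (A - {d}) S (X (A - {d})) = X S" if "S \<noteq> {}" "S \<subseteq> A - {d}" "d \<in> A" for S d
    by (rule rX) (use that in auto)
  have Obd: "A - {d} \<in> F_obs Pinf" and Xd: "d \<in> A \<Longrightarrow> X (A - {d}) \<in> el M (A - {d})" for d
  proof -
    have "A - {d} \<noteq> {}"
    proof
      assume "A - {d} = {}"
      then have "A \<subseteq> {d}" by blast
      then show False using cA card_mono[of "{d}" A] by auto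
    qed
    then show "A - {d} \<in> F_obs Pinf" and "d \<in> A \<Longrightarrow> X (A - {d}) \<in> el M (A - {d})"
      using Ob[of "A - {d}"] XS[of "A - {d}"] by auto
  qed
  \<comment> \<open>A basis of a face is a nondegenerate set of the sphere, so by maximality it is
    no larger than \<open>S\<close> and can be exchanged for \<open>S\<close>.\<close>
  have max_basis: "\<exists>r. basis M (A - {d}) (X (A - {d})) S r"
    if S: "ND S" "card S = card T" and d: "d \<in> A" "d \<notin> S" for S d
  proof -
    obtain T0 r0 where b0: "basis M (A - {d}) (X (A - {d})) T0 r0" using basis_exists[OF Obd Xd[OF d(1)]] .
    note D = basisD[OF b0 Obd Xd[OF d(1)]]
    have "ND T0" unfolding ND_def using D(1,2,7) d resd[OF D(2,1) d(1)] by auto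
    then have "card T0 \<le> card S" using Tmax S by simp
    moreover have S': "S \<subseteq> A - {d}" "S \<noteq> {}" using S d unfolding ND_def by auto
    moreover have "nondeg M S (res M (A - {d}) S (X (A - {d})))"
      using S resd[OF S'(2,1) d(1)] unfolding ND_def by simp
    ultimately show ?thesis using basis_change[OF b0 Obd Xd[OF d(1)]] by blast
  qed
  have ND_inj: "inj_on r S"
    if b: "basis M (A - {d}) (X (A - {d})) B r" and d: "d \<in> A" and S: "ND S" "S \<subseteq> A - {d}" for d B r S
    by (rule basis_inj_on[OF b Obd Xd[OF d] S(2)]) (use S resd[OF _ S(2) d] in \<open>auto simp: ND_def\<close>)
  have inj_ND: "ND S"
    if b: "basis M (A - {d}) (X (A - {d})) B r" and d: "d \<in> A"
      and S: "bij_betw r S B" "S \<subseteq> A - {d}" for d B r S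
  proof -
    have "S \<noteq> {}" using S(1) basisD(2)[OF b Obd Xd[OF d]] by (auto simp: bij_betw_def)
    then show ?thesis
      using basis_transversal[OF b Obd Xd[OF d] S(2,1)] resd[OF _ S(2) d] S d by (auto simp: ND_def)
  qed
  let ?U = "A - T"
  have cU: "card ?U = card A - card T" using TA by (simp add: card_Diff_subset)
  \<comment> \<open>Two points outside \<open>T\<close> are needed: one is deleted to give a face
    with basis \<open>T\<close>, the other receives its block there.\<close>
  then have "2 \<le> card ?U" using TA cA by simp
  then obtain b d where bd: "b \<in> ?U" "d \<in> ?U" "b \<noteq> d"
    by (metis card_le_Suc_iff insertCI numeral_2_eq_2 insertI1)
  obtain r where r: "basis M (A - {d}) (X (A - {d})) T r" using max_basis[OF T refl] bd by blast
  note D = basisD[OF r Obd Xd, OF DiffD1[OF bd(2)]]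
  define a where "a = r b"
  have aT: "a \<in> T" using D(4) bd unfolding a_def by auto
  have ab: "a \<in> A" "b \<in> A" "a \<noteq> b" using aT TA bd by auto
  have bij: "bij_betw r (insert b (T - {a})) T"
  proof (rule bij_betw_imageI)
    have *: "r ` (T - {a}) = T - {a}" using D(5) by force
    show "r ` insert b (T - {a}) = T" using * aT by (auto simp: a_def)
    show "inj_on r (insert b (T - {a}))"
      unfolding inj_on_insert using * D(5) by (auto simp: a_def inj_on_def)
  qed
  have Tb: "ND (insert b (T - {a}))" by (rule inj_ND[OF r _ bij]) (use bd TA in auto)
  \<comment> \<open>The block of \<open>b\<close> is the same in every face opposite a point outside
    \<open>T\<close>, because \<open>T\<close> with \<open>a\<close> exchanged for \<open>b\<close>
    is nondegenerate.\<close>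
  have rc: "s b = a" if s: "basis M (A - {c}) (X (A - {c})) T s" and c: "c \<in> ?U - {b}" for c s
  proof (rule ccontr)
    assume ne: "s b \<noteq> a"
    have cA: "c \<in> A" using c by auto
    note D' = basisD[OF s Obd Xd, OF cA]
    have "inj_on s (insert b (T - {a}))" by (rule ND_inj[OF s cA Tb]) (use c TA ab in auto)
    moreover have "s b \<in> T" using D'(4) c ab by auto
    ultimately have "s b = b" using ne D'(5)[of "s b"] unfolding inj_on_def by blast
    then show False using \<open>s b \<in> T\<close> bd by simp
  qed
  have inv: "pull M (A - {c}) (A - {c}) (\<lambda>v. if v = b then a else v) (X (A - {c})) = X (A - {c})"
    if c: "c \<in> A - {a, b}" and q: "basis M (A - {c}) (X (A - {c})) B q" and qab: "q a = q b" for c B q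
  proof -
    have cA: "c \<in> A" using c by auto
    note D' = basisD[OF q Obd Xd, OF cA]
    let ?x = "X (A - {c})"
    have "pull M (A - {c}) (A - {c}) (\<lambda>v. if v = b then a else v) ?x
        = pull M (A - {c}) (A - {c}) (\<lambda>v. if v = b then a else v) (pull M (A - {c}) B q (res M (A - {c}) B ?x))"
      by (simp only: D'(6))
    also have "\<dots> = pull M (A - {c}) B (\<lambda>v. q (if v = b then a else v)) (res M (A - {c}) B ?x)"
      by (rule pull_pull) (use Obd D' ab c in auto)
    also have "\<dots> = pull M (A - {c}) B q (res M (A - {c}) B ?x)"
      by (rule pull_cong) (use qab in auto)
    finally show ?thesis by (simp only: D'(6))
  qed
  show ?thesis
  proof (rule sphere_filler_of_pair[OF sk A cA X ab])
    fix c assume c: "c \<in> A - {a, b}"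
    then have cA: "c \<in> A" by auto
    obtain B q where q: "basis M (A - {c}) (X (A - {c})) B q" using basis_exists[OF Obd Xd[OF cA]] .
    note Dq = basisD[OF q Obd Xd, OF cA]
    show "pull M (A - {c}) (A - {c}) (\<lambda>v. if v = b then a else v) (X (A - {c})) = X (A - {c})"
    proof (cases "c \<in> T")
      case False
      obtain s where s: "basis M (A - {c}) (X (A - {c})) T s" using max_basis[OF T refl cA False] by blast
      have "s a = a" using basisD(5)[OF s Obd Xd aT, OF cA] .
      then have "s a = s b" using rc[OF s] c False by auto
      then show ?thesis by (rule inv[OF c s])
    next
      case True
      have "q a = q b"
      proof (rule ccontr)
        assume qab: "q a \<noteq> q b"
        \<comment> \<open>A transversal of the face through both \<open>a\<close> and
          \<open>b\<close>. If it missed a point \<open>v\<close> outside \<open>T\<close>, the face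
          opposite \<open>v\<close> would have \<open>a\<close> and \<open>b\<close> in one block by
          \<open>rc\<close>, although its retraction is injective on \<open>S\<close>.\<close>
        define S where "S = {a, b} \<union> (B - {q a, q b})"
        have fB: "finite B" using Dq(3) by (simp add: F_obs_Pinf_iff)
        have abc: "a \<in> A - {c}" "b \<in> A - {c}" using ab c by auto
        have qB: "q a \<in> B" "q b \<in> B" using Dq(4) abc by auto
        have SA: "S \<subseteq> A - {c}" using abc Dq(1) by (auto simp: S_def)
        have bijS: "bij_betw q S B"
        proof (rule bij_betw_imageI)
          have *: "q ` (B - {q a, q b}) = B - {q a, q b}" using Dq(5) by force
          show "q ` S = B" unfolding S_def image_Un * using qB by auto
          show "inj_on q S"
            unfolding S_def inj_on_Un * using qab Dq(5) by (auto simp: inj_on_def)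
        qed
        have SND: "ND S" by (rule inj_ND[OF q cA bijS SA])
        have cS: "card S \<le> card T" using Tmax[OF SND] .
        have US: "insert a ?U \<subseteq> S"
        proof
          fix v assume v: "v \<in> insert a ?U"
          show "v \<in> S"
          proof (rule ccontr)
            assume nv: "v \<notin> S"
            then have v': "v \<in> ?U - {b}" using v by (auto simp: S_def)
            then have vA: "v \<in> A" "v \<notin> T" by auto
            obtain s where s: "basis M (A - {v}) (X (A - {v})) T s" using max_basis[OF T refl vA] by blast
            have "inj_on s S" by (rule ND_inj[OF s vA(1) SND]) (use SA nv in auto)
            moreover have "s a = a" using basisD(5)[OF s Obd Xd aT, OF vA(1)] .
            then have "s a = s b" using rc[OF s v'] by simp
            ultimately show False using ab(3) unfolding inj_on_def S_def by blast
          qed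
        qed
        have fS: "finite S" using fB by (simp add: S_def)
        have cU': "card (insert a ?U) = card A - card T + 1" using cU fA aT by simp
        \<comment> \<open>With \<open>card T \<le> l + 1\<close> this gives
          \<open>card A \<le> 2 * l + 1\<close>, so the second alternative of \<open>cA'\<close>
          holds and the estimates are equalities.\<close>
        have "card A - card T + 1 \<le> card T" using card_mono[OF fS US] cU' cS by simp
        then have l: "3 \<le> l" "card A = 2 * l + 1" "card T = l + 1" using cA' TA(5) by auto
        then have "S = insert a ?U" using card_seteq[OF fS US] cU' cS by simp
        then have G2: "ND (insert a ?U)" "card (insert a ?U) = l + 1" using SND cU' l by auto
        have cb: "card (insert b (T - {a})) = l + 1" using bd aT TA(4) l by simp
        \<comment> \<open>The edges are the nondegenerate sets of \<open>l + 1\<close> points;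
          \<open>T\<close> and \<open>insert a ?U\<close> are two of them that meet only in
          \<open>a\<close>.\<close>
        show False
        proof (rule no_edges_meeting_in_one_point[where G = "\<lambda>S. ND S \<and> card S = l + 1", OF fA l(2,1)])
          fix B d assume B: "ND B \<and> card B = l + 1" and d: "d \<in> A - B"
          obtain s where s: "basis M (A - {d}) (X (A - {d})) B s" using max_basis[of B d] B d l by auto
          have dA: "d \<in> A" using d by simp
          note Ds = basisD[OF s Obd Xd, OF dA]
          have "ND V \<longleftrightarrow> inj_on s V" if V: "V \<subseteq> A - {d}" "card V = l + 1" for V
          proof
            assume "ND V" then show "inj_on s V" using ND_inj[OF s dA _ V(1)] by blast
          next
            assume i: "inj_on s V"
            have "s ` V \<subseteq> B" using Ds(4) V by auto
            moreover have "finite B" using Ds(3) by (simp add: F_obs_Pinf_iff)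
            ultimately have "s ` V = B" using card_seteq[of B "s ` V"] B V by (simp add: card_image[OF i])
            then show "ND V" using inj_ND[OF s dA _ V(1)] i by (simp add: bij_betw_def)
          qed
          then show "\<exists>r. r \<in> A - {d} \<rightarrow> B \<and> (\<forall>t\<in>B. r t = t) \<and>
            (\<forall>S. S \<subseteq> A - {d} \<and> card S = l + 1 \<longrightarrow> ((ND S \<and> card S = l + 1) \<longleftrightarrow> inj_on r S))"
            using Ds(4,5) by blast
        next
          show "ND T \<and> card T = l + 1" using T l by simp
        qed (use aT G2 bd Tb cb ND_def in auto)
      qed
      then show ?thesis by (rule inv[OF c q])
    qed
  qed
qed

end

subsection \<open>Coskeletal symmetric sets\<close>

context symset
begin

lemma cosk_unit_apply:
  "K \<in> F_obs l \<Longrightarrow> f \<in> K \<rightarrow>\<^sub>E A \<Longrightarrow> cosk_unit l M A x K f = act M K A f x"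
  by (simp add: cosk_unit_def Ran_transpose_def)

lemma cosk_unit_in:
  "A \<in> F_obs Pinf \<Longrightarrow> x \<in> el M A \<Longrightarrow> cosk_unit l M A x \<in> el (cosk l M) A"
  using Ran_right_adjoint(1)[OF sym natural_restr[of l]]
  unfolding natural_def cosk_def cosk_unit_def by blast

lemma cosk_in: "\<phi> \<in> el (cosk l M) A \<Longrightarrow> K \<in> F_obs l \<Longrightarrow> f \<in> K \<rightarrow>\<^sub>E A \<Longrightarrow> \<phi> K f \<in> el M K"
  unfolding cosk_def using el_Ran_mem by fastforce

lemma cosk_natural:
  "\<phi> \<in> el (cosk l M) A \<Longrightarrow> K \<in> F_obs l \<Longrightarrow> L \<in> F_obs l \<Longrightarrow> h \<in> K \<rightarrow>\<^sub>E L \<Longrightarrow> f \<in> L \<rightarrow>\<^sub>E A \<Longrightarrow>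
   \<phi> K (compose K f h) = act M K L h (\<phi> L f)"
  unfolding cosk_def using el_Ran_natural by fastforce

lemma cosk_eqI:
  assumes "\<phi> \<in> el (cosk l M) A" "\<psi> \<in> el (cosk l M) A"
    and "\<And>K f. K \<in> F_obs l \<Longrightarrow> f \<in> K \<rightarrow>\<^sub>E A \<Longrightarrow> \<phi> K f = \<psi> K f"
  shows "\<phi> = \<psi>"
  using assms unfolding cosk_def by (rule Ran_ext)

lemma Yoneda_determined:
  assumes \<phi>: "\<phi> \<in> el (cosk l M) A" and S: "S \<in> F_obs l" "S \<subseteq> A"
    and f: "K \<in> F_obs l" "f \<in> K \<rightarrow>\<^sub>E S"
  shows "\<phi> K f = act M K S f (\<phi> S (\<lambda>s\<in>S. s))"
proof -
  have "(\<lambda>s\<in>S. s) \<in> S \<rightarrow>\<^sub>E A" using S by auto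
  then have "\<phi> K (compose K (\<lambda>s\<in>S. s) f) = act M K S f (\<phi> S (\<lambda>s\<in>S. s))"
    by (rule cosk_natural[OF \<phi> f(1) S(1) f(2)])
  then show ?thesis using Id_compose'[OF f(2)] by simp
qed

text \<open>By Yoneda, evaluation at the identity of \<open>A\<close> inverts the unit.\<close>

lemma coskeletal_Pinf: "coskeletal Pinf M"
  unfolding coskeletal_iff_bij
proof
  fix A assume A: "A \<in> F_obs Pinf"
  show "bij_betw (cosk_unit Pinf M A) (el M A) (el (cosk Pinf M) A)"
  proof (rule bij_betw_byWitness[where f' = "\<lambda>\<phi>. \<phi> A (\<lambda>a\<in>A. a)"])
    show "\<forall>x\<in>el M A. cosk_unit Pinf M A x A (\<lambda>a\<in>A. a) = x"
      using A by (simp add: cosk_unit_apply presheaf_id[OF sym])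
    show "\<forall>\<phi>\<in>el (cosk Pinf M) A. cosk_unit Pinf M A (\<phi> A (\<lambda>a\<in>A. a)) = \<phi>"
    proof
      fix \<phi> assume \<phi>: "\<phi> \<in> el (cosk Pinf M) A"
      show "cosk_unit Pinf M A (\<phi> A (\<lambda>a\<in>A. a)) = \<phi>"
        by (rule cosk_eqI[OF cosk_unit_in[OF A cosk_in[OF \<phi> A id_PiE]] \<phi>])
          (simp add: cosk_unit_apply Yoneda_determined[OF \<phi> A])
    qed
    show "cosk_unit Pinf M A ` el M A \<subseteq> el (cosk Pinf M) A" using cosk_unit_in[OF A] by blast
    show "(\<lambda>\<phi>. \<phi> A (\<lambda>a\<in>A. a)) ` el (cosk Pinf M) A \<subseteq> el M A" using cosk_in[OF _ A id_PiE] by blast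
  qed
qed

text \<open>Injectivity of the unit is uniqueness on small subsets. For surjectivity, a given
  \<open>\<phi>\<close> is represented over larger and larger subsets of \<open>A\<close>: up to
  \<open>n + 1\<close> points by Yoneda, beyond that by filling the sphere of representatives found
  so far.\<close>

lemma coskeletal_if_fillers:
  assumes sk: "skeletal (Fin l) M" and ln: "l \<le> n"
    and fill: "\<And>A X. A \<in> F_obs Pinf \<Longrightarrow> n + 2 \<le> card A \<Longrightarrow> sphere M A X \<Longrightarrow> \<exists>x. filler M A X x"
  shows "coskeletal (Fin n) M"
  unfolding coskeletal_iff_bij
proof
  fix A assume A: "A \<in> F_obs Pinf"
  have fA: "finite A" using A by (simp add: F_obs_Pinf_iff)
  have resA: "res M S V x = act M V S (\<lambda>v\<in>V. v) x" for S V x by (simp add: pull_def)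
  show "bij_betw (cosk_unit (Fin n) M A) (el M A) (el (cosk (Fin n) M) A)"
  proof (rule bij_betw_imageI)
    show "inj_on (cosk_unit (Fin n) M A) (el M A)"
    proof (rule inj_onI)
      fix x y assume x: "x \<in> el M A" and y: "y \<in> el M A"
        and eq: "cosk_unit (Fin n) M A x = cosk_unit (Fin n) M A y"
      show "x = y"
      proof (rule eq_if_small_restrictions_eq[OF sk A x y])
        fix S assume S: "S \<subseteq> A" "S \<noteq> {}" "card S \<le> l + 1"
        have SF: "S \<in> F_obs (Fin n)" using S ln fA by (auto simp: F_obs_Fin_iff intro: finite_subset)
        have "(\<lambda>s\<in>S. s) \<in> S \<rightarrow>\<^sub>E A" using S by auto
        then show "res M A S x = res M A S y"
          unfolding resA using eq cosk_unit_apply[OF SF, of "\<lambda>s\<in>S. s" A] by metis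
      qed
    qed
    show "cosk_unit (Fin n) M A ` el M A = el (cosk (Fin n) M) A"
    proof
      show "cosk_unit (Fin n) M A ` el M A \<subseteq> el (cosk (Fin n) M) A" using cosk_unit_in[OF A] by blast
      show "el (cosk (Fin n) M) A \<subseteq> cosk_unit (Fin n) M A ` el M A"
      proof
        fix \<phi> assume \<phi>: "\<phi> \<in> el (cosk (Fin n) M) A"
        define P where "P S x \<longleftrightarrow> x \<in> el M S \<and>
          (\<forall>K\<in>F_obs (Fin n). \<forall>f\<in>K \<rightarrow>\<^sub>E S. \<phi> K f = act M K S f x)" for S x
        have "\<exists>x. P S x" if "S \<subseteq> A" "S \<noteq> {}" for S
          using that
        proof (induction "card S" arbitrary: S rule: less_induct)
          case less
          have SO: "S \<in> F_obs Pinf" using F_obs_Pinf_subset[OF A less.prems] .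
          have fS: "finite S" using SO by (simp add: F_obs_Pinf_iff)
          show ?case
          proof (cases "card S \<le> n + 1")
            case True
            then have SF: "S \<in> F_obs (Fin n)" using fS less.prems by (simp add: F_obs_Fin_iff)
            have "(\<lambda>s\<in>S. s) \<in> S \<rightarrow>\<^sub>E A" using less.prems by auto
            then have "P S (\<phi> S (\<lambda>s\<in>S. s))"
              unfolding P_def using Yoneda_determined[OF \<phi> SF less.prems(1)] cosk_in[OF \<phi> SF] by blast
            then show ?thesis ..
          next
            case False
            have "\<exists>x. P V x" if "V \<noteq> {}" "V \<subset> S" for V
              using less.hyps[of V] that less.prems psubset_card_mono[OF fS that(2)] by blast
            then obtain X where X: "\<And>V. V \<noteq> {} \<Longrightarrow> V \<subset> S \<Longrightarrow> P V (X V)" by metis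
            have XP: "\<phi> K f = act M K V f (X V)"
              if "V \<noteq> {}" "V \<subset> S" "K \<in> F_obs (Fin n)" "f \<in> K \<rightarrow>\<^sub>E V" for V K f
              using X[OF that(1,2)] that(3,4) unfolding P_def by blast
            have Xin: "X V \<in> el M V" if "V \<noteq> {}" "V \<subset> S" for V
              using X[OF that] unfolding P_def by blast
            have small: "res M V W (X V) = \<phi> W (\<lambda>w\<in>W. w)"
              if "W \<noteq> {}" "W \<subseteq> V" "V \<subset> S" "card W \<le> n + 1" for V W
            proof -
              have "W \<in> F_obs (Fin n)" using that fS finite_subset[of W S] by (auto simp: F_obs_Fin_iff)
              moreover have "(\<lambda>w\<in>W. w) \<in> W \<rightarrow>\<^sub>E V" using that by auto
              moreover have "V \<noteq> {}" using that by auto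
              ultimately show ?thesis unfolding resA using XP[of V W] that(3) by simp
            qed
            have VO: "V \<in> F_obs Pinf" if "V \<noteq> {}" "V \<subseteq> S" for V using F_obs_Pinf_subset[OF SO] that by blast
            \<comment> \<open>The representatives were chosen independently; they are compatible
              because \<open>\<phi>\<close> prescribes their small restrictions.\<close>
            have "res M V' V (X V') = X V" if V: "V \<noteq> {}" "V \<subseteq> V'" "V' \<subset> S" for V V'
            proof (rule eq_if_small_restrictions_eq[OF sk VO])
              have V': "V' \<noteq> {}" "V \<subset> S" "V' \<subseteq> S" using V by auto
              show "V \<noteq> {}" "V \<subseteq> S" using V by auto
              show "res M V' V (X V') \<in> el M V" by (rule res_in) (use V V' VO Xin in auto)
              show "X V \<in> el M V" using Xin V V' by blast
              fix W assume W: "W \<subseteq> V" "W \<noteq> {}" "card W \<le> l + 1"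
              have "res M V W (res M V' V (X V')) = res M V' W (X V')"
                by (rule res_res) (use W V V' VO Xin in auto)
              also have "\<dots> = res M V W (X V)" using small[of W V] small[of W V'] W V V' ln by auto
              finally show "res M V W (res M V' V (X V')) = res M V W (X V)" .
            qed
            then have "sphere M S X" unfolding sphere_def using Xin by blast
            moreover have "n + 2 \<le> card S" using False by simp
            ultimately obtain x where "filler M S X x" using fill[OF SO] by blast
            then have x: "x \<in> el M S" "\<And>V. V \<noteq> {} \<Longrightarrow> V \<subset> S \<Longrightarrow> res M S V x = X V"
              unfolding filler_def by blast+
            have "\<phi> K f = act M K S f x" if K: "K \<in> F_obs (Fin n)" and f: "f \<in> K \<rightarrow>\<^sub>E S" for K f
            proof -
              \<comment> \<open>\<open>K\<close> has fewer points than \<open>S\<close>, so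
                \<open>f\<close> factors through a proper subset, where the filler is known.\<close>
              define V where "V = f ` K"
              have KO: "K \<in> F_obs Pinf" using F_obs_Pinf[OF K] .
              have "card V \<le> card K" unfolding V_def using K by (intro card_image_le) (simp add: F_obs_Fin_iff)
              then have "card V < card S" using False K by (simp add: F_obs_Fin_iff)
              then have V: "V \<noteq> {}" "V \<subset> S" using K f by (auto simp: V_def F_obs_Fin_iff)
              have fV: "f \<in> K \<rightarrow>\<^sub>E V" using f by (auto simp: V_def)
              have "\<phi> K f = pull M K V f (res M S V x)"
                using XP[OF V K fV] x(2)[OF V] fV by (simp add: pull_act)
              also have "\<dots> = pull M K S f x" by (rule pull_res[OF KO SO]) (use V fV x in auto)
              finally show ?thesis using f by (simp add: pull_act)
            qed
            then have "P S x" unfolding P_def using x by blast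
            then show ?thesis ..
          qed
        qed
        then obtain x where x: "P A x" using A by (auto simp: F_obs_Pinf_iff)
        then have "cosk_unit (Fin n) M A x = \<phi>"
          by (intro cosk_eqI[OF cosk_unit_in[OF A] \<phi>]) (auto simp: P_def cosk_unit_apply)
        then show "\<phi> \<in> cosk_unit (Fin n) M A ` el M A" using x unfolding P_def by blast
      qed
    qed
  qed
qed

text \<open>A map into \<open>A\<close> from at most \<open>n + 1\<close> points misses a point, so
  the sphere has an element over its image, which is pulled back along the map. These values form an
  element of the coskeleton; the \<open>x\<close> it comes from agrees with the sphere on small
  sets, hence on all proper subsets.\<close>

lemma filler_if_coskeletal:
  assumes sk: "skeletal (Fin l) M" and cosk: "coskeletal (Fin n) M" and ln: "l \<le> n"
    and A: "A \<in> F_obs Pinf" and cA: "n + 2 \<le> card A" and X: "sphere M A X"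
  shows "\<exists>x. filler M A X x"
proof -
  have fA: "finite A" using A by (simp add: F_obs_Pinf_iff)
  have XS: "X S \<in> el M S" if "S \<noteq> {}" "S \<subset> A" for S using X that unfolding sphere_def by blast
  have rX: "res M S' S (X S') = X S" if "S \<noteq> {}" "S \<subseteq> S'" "S' \<subset> A" for S S'
    using X that unfolding sphere_def by blast
  have Ob: "S \<in> F_obs Pinf" if "S \<noteq> {}" "S \<subseteq> A" for S using F_obs_Pinf_subset[OF A] that by blast
  have im: "f ` K \<noteq> {}" "f ` K \<subset> A" if "K \<in> F_obs (Fin n)" "f \<in> K \<rightarrow>\<^sub>E A" for K f
  proof -
    show "f ` K \<noteq> {}" using that by (auto simp: F_obs_Fin_iff)
    have "card (f ` K) \<le> card K" using that by (intro card_image_le) (simp add: F_obs_Fin_iff)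
    then have "f ` K \<noteq> A" using cA that by (auto simp: F_obs_Fin_iff)
    then show "f ` K \<subset> A" using that by auto
  qed
  define \<phi> where "\<phi> = (\<lambda>K\<in>F_obs (Fin n). \<lambda>f\<in>K \<rightarrow>\<^sub>E A. pull M K (f ` K) f (X (f ` K)))"
  have \<phi>: "\<phi> K f = pull M K (f ` K) f (X (f ` K))" if "K \<in> F_obs (Fin n)" "f \<in> K \<rightarrow>\<^sub>E A" for K f
    using that by (simp add: \<phi>_def)
  have \<phi>in: "pull M K (f ` K) f (X (f ` K)) \<in> el M K" if "K \<in> F_obs (Fin n)" "f \<in> K \<rightarrow>\<^sub>E A" for K f
    by (rule pull_in) (use im[OF that] that F_obs_Pinf Ob XS in auto)
  have "\<phi> \<in> el (cosk (Fin n) M) A"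
  proof -
    have 1: "\<phi> \<in> (\<Pi>\<^sub>E K\<in>F_obs (Fin n). (K \<rightarrow>\<^sub>E A) \<rightarrow>\<^sub>E el (restr (Fin n) M) K)"
      using \<phi>in by (simp add: \<phi>_def restrict_PiE_iff del: restrict_PiE)
    have 2: "\<phi> K (compose K f h) = act (restr (Fin n) M) K L h (\<phi> L f)"
      if KL: "K \<in> F_obs (Fin n)" "L \<in> F_obs (Fin n)" and h: "h \<in> K \<rightarrow>\<^sub>E L" and f: "f \<in> L \<rightarrow>\<^sub>E A" for K L h f
    proof -
      let ?V = "compose K f h ` K"
      note imL = im[OF KL(2) f] and imK = im[OF KL(1) compose_PiE[OF h f]]
      have VL: "?V \<subseteq> f ` L" using h by (auto simp: compose_def)
      have ch: "compose K f h \<in> K \<rightarrow> ?V" by auto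
      have KO: "K \<in> F_obs Pinf" "L \<in> F_obs Pinf" "f ` L \<in> F_obs Pinf"
        using F_obs_Pinf KL Ob imL by auto
      have "\<phi> K (compose K f h) = pull M K ?V (compose K f h) (res M (f ` L) ?V (X (f ` L)))"
        using \<phi>[OF KL(1) compose_PiE[OF h f]] rX[OF imK(1) VL imL(2)] by simp
      also have "\<dots> = pull M K (f ` L) (compose K f h) (X (f ` L))"
        by (rule pull_res[OF KO(1,3) VL ch XS[OF imL]])
      also have "\<dots> = pull M K (f ` L) (\<lambda>k. f (h k)) (X (f ` L))"
        by (rule pull_cong) (simp add: compose_def)
      also have "\<dots> = pull M K L h (pull M L (f ` L) f (X (f ` L)))"
        by (rule pull_pull[symmetric]) (use KO h XS[OF imL] in auto)
      also have "\<dots> = act M K L h (\<phi> L f)" using \<phi>[OF KL(2) f] h by (simp add: pull_act)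
      finally show ?thesis using KL by simp
    qed
    show ?thesis unfolding cosk_def using 1 2 by (subst Ran_def) simp
  qed
  then obtain x where x: "x \<in> el M A" "\<phi> = cosk_unit (Fin n) M A x"
    using cosk A unfolding coskeletal_iff_bij bij_betw_def by blast
  have small: "res M A V x = X V" if V: "V \<noteq> {}" "V \<subset> A" "card V \<le> l + 1" for V
  proof -
    have VF: "V \<in> F_obs (Fin n)" using V ln fA by (auto simp: F_obs_Fin_iff intro: finite_subset)
    have i: "(\<lambda>v\<in>V. v) \<in> V \<rightarrow>\<^sub>E A" using V by auto
    have "res M A V x = cosk_unit (Fin n) M A x V (\<lambda>v\<in>V. v)"
      using cosk_unit_apply[OF VF i] by (simp add: pull_def)
    also have "\<dots> = pull M V V (\<lambda>v\<in>V. v) (X V)" unfolding x(2)[symmetric] using \<phi>[OF VF i] by simp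
    also have "\<dots> = X V" by (rule pull_id) (use V Ob XS in auto)
    finally show ?thesis .
  qed
  have "res M A S x = X S" if S: "S \<noteq> {}" "S \<subset> A" for S
  proof (rule eq_if_small_restrictions_eq[OF sk Ob])
    show "S \<noteq> {}" "S \<subseteq> A" using S by auto
    show "res M A S x \<in> el M S" by (rule res_in) (use S A x in auto)
    show "X S \<in> el M S" by (rule XS[OF S])
    fix V assume V: "V \<subseteq> S" "V \<noteq> {}" "card V \<le> l + 1"
    have "res M S V (res M A S x) = res M A V x" by (rule res_res) (use A x S V in auto)
    also have "\<dots> = X V" using small V S by auto
    also have "\<dots> = res M S V (X S)" by (rule rX[symmetric]) (use V S in auto)
    finally show "res M S V (res M A S x) = res M S V (X S)" .
  qed
  then show ?thesis unfolding filler_def using x by blast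
qed

section \<open>The bottom level\<close>

lemma skeletal_Minf_empty: "skeletal Minf M \<Longrightarrow> A \<in> F_obs Pinf \<Longrightarrow> el M A = {}"
  using skeletal_factor[of Minf A] by (auto simp: F_obs_def)

text \<open>One-point sets belong to every level \<open>Fin n\<close>, so an element of the
  coskeleton at \<open>A\<close> would evaluate at a point of \<open>A\<close> to an element of an
  empty set.\<close>

lemma coskeletal_if_empty:
  assumes "\<And>A. A \<in> F_obs Pinf \<Longrightarrow> el M A = {}"
  shows "coskeletal (Fin n) M"
  unfolding coskeletal_iff_bij
proof
  fix A assume A: "A \<in> F_obs Pinf"
  then obtain a where a: "a \<in> A" by (auto simp: F_obs_Pinf_iff)
  then have F: "{a} \<in> F_obs (Fin n)" by (simp add: F_obs_Fin_iff)
  have "\<phi> \<notin> el (cosk (Fin n) M) A" for \<phi>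
    using cosk_in[OF _ F, of \<phi> A "\<lambda>v\<in>{a}. v"] a assms[of "{a}"] F_obs_Pinf[OF F] by auto
  then show "bij_betw (cosk_unit (Fin n) M A) (el M A) (el (cosk (Fin n) M) A)"
    using assms[OF A] by (auto simp: bij_betw_def)
qed

end

subsection \<open>Hypergraphs of transversals\<close>

text \<open>A partition of \<open>A\<close> into \<open>l + 1\<close> blocks is encoded by its set of transversals, an
  \<open>(l + 1)\<close>-uniform hypergraph on \<open>A\<close>, so that restriction to a subset merely selects the
  transversals contained in it.\<close>

definition transversals :: "nat \<Rightarrow> nat set \<Rightarrow> (nat \<Rightarrow> nat) \<Rightarrow> nat set set" where
  "transversals l A g = {T. T \<subseteq> A \<and> card T = l + 1 \<and> g ` T = {..l}}"

text \<open>\<open>{}\<close> is the additional element; a colouring that misses a colour yields it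
  too. Permuting the colours does not change the hypergraph, so only the partition is
  recorded.\<close>

definition hyp :: "nat \<Rightarrow> nat set \<Rightarrow> nat set set set" where
  "hyp l A = insert {} (transversals l A ` (A \<rightarrow> {..l}))"

definition hpull :: "nat \<Rightarrow> nat set \<Rightarrow> (nat \<Rightarrow> nat) \<Rightarrow> nat set set \<Rightarrow> nat set set" where
  "hpull l A f H = {T. T \<subseteq> A \<and> card T = l + 1 \<and> f ` T \<in> H}"

text \<open>A countable set containing all these hypergraphs on finite sets, which therefore embed
  into every infinite universe.\<close>

definition fin_hyps :: "nat set set set" where
  "fin_hyps = {H. finite H \<and> H \<subseteq> {T. finite T}}"

text \<open>The injection \<open>c\<close> transports the hypergraphs to the prescribed universe.\<close>

definition hpsh :: "nat \<Rightarrow> (nat set set \<Rightarrow> 'a) \<Rightarrow> 'a psh" where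
  "hpsh l c = \<lparr>el = (\<lambda>A. c ` hyp l A), act = (\<lambda>A B f x. c (hpull l A f (inv_into fin_hyps c x)))\<rparr>"

lemma countable_fin_hyps: "countable fin_hyps"
proof -
  have "countable {T :: nat set. finite T}"
    using countable_Collect_finite .
  then show ?thesis unfolding fin_hyps_def by (rule countable_Collect_finite_subset)
qed

lemma hyp_subset: "H \<in> hyp l A \<Longrightarrow> T \<in> H \<Longrightarrow> T \<subseteq> A \<and> card T = l + 1"
  by (auto simp: hyp_def transversals_def)

lemma hyp_fin_hyps: "finite A \<Longrightarrow> H \<in> hyp l A \<Longrightarrow> H \<in> fin_hyps"
  unfolding fin_hyps_def
  using hyp_subset[of H l A] by (auto intro: finite_subset[of H "Pow A"] finite_subset[of _ A])

text \<open>A set of \<open>l + 1\<close> points showing all \<open>l + 1\<close> colours cannot be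
  collapsed by \<open>f\<close>.\<close>

lemma hpull_transversals:
  assumes f: "f \<in> A \<rightarrow> B"
  shows "hpull l A f (transversals l B g) = transversals l A (\<lambda>a. g (f a))"
proof -
  have "f ` T \<in> transversals l B g \<longleftrightarrow> (\<lambda>a. g (f a)) ` T = {..l}" if T: "T \<subseteq> A" "card T = l + 1" for T
  proof
    assume "f ` T \<in> transversals l B g"
    then show "(\<lambda>a. g (f a)) ` T = {..l}" by (simp add: transversals_def image_image)
  next
    assume im: "(\<lambda>a. g (f a)) ` T = {..l}"
    have "finite T" using T(2) by (simp add: card_ge_0_finite)
    then have "card (f ` T) \<le> l + 1" "card (g ` f ` T) \<le> card (f ` T)"
      using card_image_le[of T f] T(2) by (simp_all add: card_image_le)
    moreover have "g ` f ` T = {..l}" using im by (simp add: image_image)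
    ultimately have "card (f ` T) = l + 1" by simp
    then show "f ` T \<in> transversals l B g"
      using \<open>g ` f ` T = {..l}\<close> T(1) f by (auto simp: transversals_def)
  qed
  then show ?thesis unfolding hpull_def transversals_def[of l A] by blast
qed

lemma hpull_in:
  assumes f: "f \<in> A \<rightarrow> B" and H: "H \<in> hyp l B"
  shows "hpull l A f H \<in> hyp l A"
proof (cases "H = {}")
  case True
  then show ?thesis by (simp add: hpull_def hyp_def)
next
  case False
  then obtain g where g: "g \<in> B \<rightarrow> {..l}" "H = transversals l B g" using H by (auto simp: hyp_def)
  have "(\<lambda>a. g (f a)) \<in> A \<rightarrow> {..l}" using f g(1) by auto
  then show ?thesis unfolding g(2) hpull_transversals[OF f] hyp_def by blast
qed

lemma hpull_cong: "(\<And>a. a \<in> A \<Longrightarrow> f a = g a) \<Longrightarrow> hpull l A f H = hpull l A g H"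
  unfolding hpull_def by (metis (no_types, lifting) image_cong subsetD)

lemma hpull_id: "H \<in> hyp l A \<Longrightarrow> hpull l A (\<lambda>a. a) H = H"
  using hyp_subset[of H l A] by (auto simp: hpull_def)

lemma hpull_hpull:
  assumes f: "f \<in> A \<rightarrow> B" and H: "H \<in> hyp l D"
  shows "hpull l A f (hpull l B g H) = hpull l A (\<lambda>a. g (f a)) H"
proof -
  have "card (f ` T) = l + 1" if "card T = l + 1" "g ` f ` T \<in> H" for T
  proof -
    have fT: "finite T" using that(1) by (simp add: card_ge_0_finite)
    have "card (g ` f ` T) = l + 1" using hyp_subset[OF H that(2)] by simp
    moreover have "card (g ` f ` T) \<le> card (f ` T)" using fT by (simp add: card_image_le)
    moreover have "card (f ` T) \<le> card T" using fT by (simp add: card_image_le)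
    ultimately show ?thesis using that(1) by simp
  qed
  moreover have "f ` T \<subseteq> B" if "T \<subseteq> A" for T using f that by auto
  ultimately show ?thesis unfolding hpull_def by (auto simp: image_image)
qed

section \<open>The symmetric set of hypergraphs\<close>

lemma hpsh_el: "el (hpsh l c) A = c ` hyp l A"
  by (simp add: hpsh_def)

lemma hpsh_act:
  assumes "inj_on c fin_hyps" "B \<in> F_obs Pinf" "H \<in> hyp l B"
  shows "act (hpsh l c) A B f (c H) = c (hpull l A f H)"
  using hyp_fin_hyps[of B H l] assms by (simp add: hpsh_def F_obs_Pinf_iff)

lemma symmetric_set_hpsh:
  assumes c: "inj_on c fin_hyps"
  shows "symmetric_set (hpsh l c)"
  unfolding presheaf_def
proof (intro conjI ballI)
  fix A B f x
  assume "A \<in> F_obs Pinf" "B \<in> F_obs Pinf" and f: "f \<in> A \<rightarrow>\<^sub>E B" and "x \<in> el (hpsh l c) B"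
  moreover have "f \<in> A \<rightarrow> B" using f by auto
  ultimately show "act (hpsh l c) A B f x \<in> el (hpsh l c) A"
    by (auto simp: hpsh_el hpsh_act[OF c] hpull_in)
next
  fix A x assume "A \<in> F_obs Pinf" "x \<in> el (hpsh l c) A"
  moreover have "hpull l A (\<lambda>a\<in>A. a) H = H" if "H \<in> hyp l A" for H
    using hpull_cong[of A "\<lambda>a\<in>A. a" "\<lambda>a. a"] hpull_id[OF that] by simp
  ultimately show "act (hpsh l c) A A (\<lambda>a\<in>A. a) x = x"
    by (auto simp: hpsh_el hpsh_act[OF c])
next
  fix A B D f g x
  assume A: "A \<in> F_obs Pinf" and B: "B \<in> F_obs Pinf" and D: "D \<in> F_obs Pinf"
    and f: "f \<in> A \<rightarrow>\<^sub>E B" and g: "g \<in> B \<rightarrow>\<^sub>E D" and "x \<in> el (hpsh l c) D"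
  then obtain H where H: "H \<in> hyp l D" "x = c H" by (auto simp: hpsh_el)
  have f': "f \<in> A \<rightarrow> B" and g': "g \<in> B \<rightarrow> D" using f g by auto
  have "hpull l A (compose A g f) H = hpull l A (\<lambda>a. g (f a)) H"
    by (rule hpull_cong) (simp add: compose_def)
  then show "act (hpsh l c) A D (compose A g f) x = act (hpsh l c) A B f (act (hpsh l c) B D g x)"
    using H by (simp add: hpsh_act[OF c D] hpsh_act[OF c B] hpull_in[OF g'] hpull_hpull[OF f'])
qed

lemma hpsh_pull:
  assumes "inj_on c fin_hyps" "B \<in> F_obs Pinf" "H \<in> hyp l B"
  shows "pull (hpsh l c) A B f (c H) = c (hpull l A f H)"
proof -
  have "hpull l A (restrict f A) H = hpull l A f H" by (rule hpull_cong) simp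
  then show ?thesis unfolding pull_def using hpsh_act[OF assms] by metis
qed

text \<open>A partition is pulled back, along its colouring, from the partition of
  \<open>{..l}\<close> into singletons; \<open>{}\<close> is pulled back from a one-point
  set.\<close>

lemma skeletal_hpsh:
  assumes c: "inj_on c fin_hyps"
  shows "skeletal (Fin l) (hpsh l c)"
proof -
  interpret symset "hpsh l c" by standard (rule symmetric_set_hpsh[OF c])
  show ?thesis
  proof (rule skeletalI)
    fix A x assume A: "A \<in> F_obs Pinf" and "x \<in> el (hpsh l c) A"
    then obtain H where H: "H \<in> hyp l A" "x = c H" by (auto simp: hpsh_el)
    show "\<exists>K\<in>F_obs (Fin l). \<exists>f\<in>A \<rightarrow> K. \<exists>y\<in>el (hpsh l c) K. x = pull (hpsh l c) A K f y"
    proof (cases "H = {}")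
      case True
      have "{} \<in> hyp l {0}" by (simp add: hyp_def)
      moreover have "{0} \<in> F_obs (Fin l)" by (simp add: F_obs_Fin_iff)
      moreover have "pull (hpsh l c) A {0} (\<lambda>_. 0) (c {}) = x"
        using hpsh_pull[OF c, of "{0}" "{}" l] True H
        by (simp add: F_obs_Pinf_iff hyp_def hpull_def)
      ultimately show ?thesis
        by (intro bexI[of _ "{0}"] bexI[of _ "\<lambda>_. 0"] bexI[of _ "c {}"]) (auto simp: hpsh_el)
    next
      case False
      then obtain g where g: "g \<in> A \<rightarrow> {..l}" "H = transversals l A g" using H by (auto simp: hyp_def)
      let ?y = "transversals l {..l} (\<lambda>i. i)"
      have y: "?y \<in> hyp l {..l}" by (auto simp: hyp_def)
      have K: "{..l} \<in> F_obs (Fin l)" by (auto simp: F_obs_Fin_iff)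
      have "x = pull (hpsh l c) A {..l} g (c ?y)"
        using hpsh_pull[OF c F_obs_Pinf[OF K] y] hpull_transversals[OF g(1)] g H by simp
      then show ?thesis using K y g(1) by (auto simp: hpsh_el)
    qed
  qed
qed

section \<open>Spheres of hypergraphs without a filler\<close>

lemma not_skeletal_imp_coskeletal:
  assumes inf: "infinite (UNIV :: 'a set)" and ln: "l \<le> n" and A: "finite A" "n + 2 \<le> card A"
    and face: "\<And>a. a \<in> A \<Longrightarrow> {T \<in> G. a \<notin> T} \<in> hyp l (A - {a})"
    and G: "G \<subseteq> {T. T \<subseteq> A \<and> card T = l + 1}" and nG: "G \<notin> hyp l A"
  shows "\<not> skeletal_imp_coskeletal TYPE('a) (Fin l) (Fin n)"
proof
  assume imp: "skeletal_imp_coskeletal TYPE('a) (Fin l) (Fin n)"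
  from inf obtain e :: "nat \<Rightarrow> 'a" where e: "inj e" using infinite_countable_subset by blast
  define c where "c H = e (to_nat_on fin_hyps H)" for H
  have c: "inj_on c fin_hyps"
    using inj_on_to_nat_on[OF countable_fin_hyps] e unfolding c_def inj_on_def by blast
  let ?M = "hpsh l c"
  have sym: "symmetric_set ?M" by (rule symmetric_set_hpsh[OF c])
  then interpret symset ?M by unfold_locales
  have sk: "skeletal (Fin l) ?M" by (rule skeletal_hpsh[OF c])
  then have cosk: "coskeletal (Fin n) ?M" using imp sym unfolding skeletal_imp_coskeletal_def by blast
  have AO: "A \<in> F_obs Pinf" using A by (auto simp: F_obs_Pinf_iff)
  have Ob: "S \<in> F_obs Pinf" if "S \<noteq> {}" "S \<subseteq> A" for S using F_obs_Pinf_subset[OF AO that(2,1)] .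
  \<comment> \<open>The hypergraphs induced by \<open>G\<close> on the proper subsets of
    \<open>A\<close> form the sphere.\<close>
  define R where "R S = {T \<in> G. T \<subseteq> S}" for S
  have hR: "hpull l S (\<lambda>s. s) (R S') = R S" if "S \<subseteq> S'" for S S'
    using that G by (auto simp: hpull_def R_def)
  have RS: "R S \<in> hyp l S" if S: "S \<noteq> {}" "S \<subset> A" for S
  proof -
    from S obtain a where a: "a \<in> A" "S \<subseteq> A - {a}" by blast
    have "R (A - {a}) = {T \<in> G. a \<notin> T}" using G by (auto simp: R_def)
    then have "R (A - {a}) \<in> hyp l (A - {a})" using face[OF a(1)] by simp
    then have "hpull l S (\<lambda>s. s) (R (A - {a})) \<in> hyp l S" by (rule hpull_in[rotated]) (use a in auto)
    then show ?thesis using hR[OF a(2)] by simp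
  qed
  define X where "X S = c (R S)" for S
  have "sphere ?M A X"
    unfolding sphere_def
  proof (intro conjI allI impI)
    fix S assume "S \<noteq> {}" "S \<subset> A"
    then show "X S \<in> el ?M S" using RS by (simp add: X_def hpsh_el)
  next
    fix S S' assume S: "S \<noteq> {}" "S \<subseteq> S'" "S' \<subset> A"
    then have S': "S' \<noteq> {}" "S' \<in> F_obs Pinf" using Ob[of S'] by auto
    show "res ?M S' S (X S') = X S"
      unfolding X_def using hpsh_pull[OF c S'(2) RS[OF S'(1) S(3)]] hR[OF S(2)] by simp
  qed
  then obtain x where x: "filler ?M A X x"
    using filler_if_coskeletal[OF sk cosk ln AO A(2)] by blast
  then obtain H where H: "H \<in> hyp l A" "x = c H" by (auto simp: filler_def hpsh_el)
  \<comment> \<open>A possible edge has fewer points than \<open>A\<close>, so the sphere decides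
    whether it belongs to \<open>H\<close>; hence a filler can only be \<open>G\<close>
    itself.\<close>
  have "T \<in> H \<longleftrightarrow> T \<in> G" if T: "T \<subseteq> A" "card T = l + 1" for T
  proof -
    have "T \<noteq> A" using T A ln by auto
    moreover have T0: "T \<noteq> {}" using T by auto
    ultimately have TA: "T \<subset> A" using T by auto
    have "c (hpull l T (\<lambda>t. t) H) = c (R T)"
      using x T0 TA hpsh_pull[OF c AO H(1)] H(2) unfolding filler_def X_def by metis
    moreover have "hpull l T (\<lambda>t. t) H \<in> hyp l T" by (rule hpull_in[OF _ H(1)]) (use T in auto)
    moreover have "finite T" using T A finite_subset by blast
    ultimately have "hpull l T (\<lambda>t. t) H = R T"
      using c RS[OF T0 TA] hyp_fin_hyps unfolding inj_on_def by blast
    then show ?thesis using T unfolding hpull_def R_def by auto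
  qed
  then have "H = G" using G hyp_subset[OF H(1)] by blast
  then show False using H nG by simp
qed

text \<open>In the partition behind this hypergraph the points of \<open>S\<close> are singleton
  blocks and \<open>D\<close> is the remaining block.\<close>

lemma star_in_hyp:
  assumes S: "finite S" "card S = l" "S \<inter> D = {}"
  shows "(\<lambda>d. insert d S) ` D \<in> hyp l (S \<union> D)"
proof -
  obtain h where h: "bij_betw h S {..<l}"
    using S finite_same_card_bij[of S "{..<l}"] by auto
  define g where "g v = (if v \<in> S then h v else l)" for v
  have gS: "g ` S = {..<l}" using h by (simp add: g_def bij_betw_def)
  have hl: "h s < l" if "s \<in> S" for s using h that by (auto simp: bij_betw_def)
  have "transversals l (S \<union> D) g = (\<lambda>d. insert d S) ` D"
  proof (intro equalityI subsetI)
    fix T assume "T \<in> transversals l (S \<union> D) g"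
    then have T: "T \<subseteq> S \<union> D" "card T = l + 1" "g ` T = {..l}" by (auto simp: transversals_def)
    have ST: "S \<subseteq> T"
    proof
      fix s assume s: "s \<in> S"
      then have "h s \<in> g ` T" using T(3) hl[OF s] by simp
      then obtain v where v: "v \<in> T" "g v = h s" by auto
      then have "v \<in> S" using hl[OF s] by (auto simp: g_def split: if_splits)
      then have "v = s" using v(2) s h by (auto simp: g_def bij_betw_def inj_on_def)
      then show "s \<in> T" using v by simp
    qed
    have "card (T - S) = 1" using ST T(2) S by (simp add: card_Diff_subset)
    then obtain d where "T - S = {d}" by (auto simp: card_1_singleton_iff)
    then show "T \<in> (\<lambda>d. insert d S) ` D" using ST T(1) by blast
  next
    fix T assume "T \<in> (\<lambda>d. insert d S) ` D"
    then obtain d where d: "d \<in> D" "T = insert d S" by auto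
    then have "d \<notin> S" using S by auto
    then have "g ` T = insert l {..<l}" using gS d by (simp add: g_def[of d])
    also have "\<dots> = {..l}" by auto
    finally show "T \<in> transversals l (S \<union> D) g"
      using d \<open>d \<notin> S\<close> S by (auto simp: transversals_def)
  qed
  moreover have "g \<in> S \<union> D \<rightarrow> {..l}" using hl by (auto simp: g_def less_imp_le)
  ultimately show ?thesis unfolding hyp_def by (metis image_eqI insertCI)
qed

text \<open>Completing the same \<open>R\<close> puts \<open>d\<close> and \<open>d'\<close> into
  the one block that \<open>R\<close> misses, but the transversal \<open>T\<close> contains
  both.\<close>

lemma not_in_hyp:
  assumes T: "T \<in> G" "d \<in> T" "d' \<in> T" "d \<noteq> d'"
    and R: "insert d R \<in> G" "insert d' R \<in> G" "d \<notin> R" "d' \<notin> R"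
  shows "G \<notin> hyp l A"
proof
  assume "G \<in> hyp l A"
  then obtain g where g: "G = transversals l A g" using T(1) by (auto simp: hyp_def)
  have *: "g ` V = {..l}" "inj_on g V" if "V \<in> G" for V
  proof -
    show im: "g ` V = {..l}" using that by (simp add: g transversals_def)
    have "card V = l + 1" using that by (simp add: g transversals_def)
    then show "inj_on g V" using im by (intro eq_card_imp_inj_on) (auto simp: card_ge_0_finite)
  qed
  have "insert (g d) (g ` R) = insert (g d') (g ` R)" using *(1)[OF R(1)] *(1)[OF R(2)] by simp
  moreover have "g d \<notin> g ` R" using *(2)[OF R(1)] R(3) by (auto simp: inj_on_def)
  moreover have "g d' \<notin> g ` R" using *(2)[OF R(2)] R(4) by (auto simp: inj_on_def)
  ultimately have "g d = g d'" by blast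
  then show False using *(2)[OF T(1)] T(2-4) by (auto simp: inj_on_def)
qed

text \<open>Of two points only \<open>0\<close> is marked; for \<open>l = 0\<close> the one-block
  partition marks both points and \<open>{}\<close> marks none.\<close>

lemma not_coskeletal_0:
  assumes "infinite (UNIV :: 'a set)"
  shows "\<not> skeletal_imp_coskeletal TYPE('a) (Fin 0) (Fin 0)"
proof (rule not_skeletal_imp_coskeletal[OF assms, where A = "{0, 1}" and G = "{{0}}"])
  fix a :: nat assume "a \<in> {0, 1}"
  then consider "a = 0" | "a = 1" by auto
  then show "{T \<in> {{0}}. a \<notin> T} \<in> hyp 0 ({0, 1} - {a})"
  proof cases
    case 1
    then show ?thesis by (simp add: hyp_def)
  next
    case 2
    have "{T \<in> {{0}}. a \<notin> T} = (\<lambda>d. insert d {}) ` {0}" "{0, 1} - {a} = {} \<union> {0}" using 2 by auto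
    then show ?thesis using star_in_hyp[of "{}" 0 "{0}"] by simp
  qed
next
  have "{{0}} \<noteq> transversals 0 {0, 1} g" if "g \<in> {0, 1} \<rightarrow> {..0}" for g :: "nat \<Rightarrow> nat"
  proof -
    have "{1} \<in> transversals 0 {0, 1} g" using that by (auto simp: transversals_def)
    then show ?thesis by (metis One_nat_def singletonD singleton_inject zero_neq_one)
  qed
  then show "{{0}} \<notin> hyp 0 {0, 1}" unfolding hyp_def by blast
qed auto

text \<open>A triangle is not bipartite, although each of its sides is a complete bipartite graph on
  two vertices.\<close>

lemma not_coskeletal_1:
  assumes "infinite (UNIV :: 'a set)"
  shows "\<not> skeletal_imp_coskeletal TYPE('a) (Fin 1) (Fin 1)"
proof -
  let ?G = "{{0, 1}, {0, 2}, {1, 2}} :: nat set set"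
  show ?thesis
  proof (rule not_skeletal_imp_coskeletal[OF assms, where A = "{0, 1, 2}" and G = ?G])
    fix a :: nat assume "a \<in> {0, 1, 2}"
    then consider "a = 0" | "a = 1" | "a = 2" by auto
    then obtain p q where pq: "p \<noteq> q" "{0, 1, 2} - {a} = {p} \<union> {q}" "{T \<in> ?G. a \<notin> T} = (\<lambda>d. insert d {p}) ` {q}"
    proof cases
      case 1
      show thesis by (rule that[of 2 1]) (use 1 in auto)
    next
      case 2
      show thesis by (rule that[of 2 0]) (use 2 in auto)
    next
      case 3
      show thesis by (rule that[of 1 0]) (use 3 in auto)
    qed
    have "(\<lambda>d. insert d {p}) ` {q} \<in> hyp 1 ({p} \<union> {q})" by (rule star_in_hyp) (use pq(1) in auto)
    then show "{T \<in> ?G. a \<notin> T} \<in> hyp 1 ({0, 1, 2} - {a})" unfolding pq(2,3) .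
  next
    show "?G \<notin> hyp 1 {0, 1, 2}"
      by (rule not_in_hyp[where T = "{1, 2}" and d = 1 and d' = 2 and R = "{0}"]) auto
  qed auto
qed

text \<open>The vertices are those of a pentagon; an edge is the triple formed by a side and the
  opposite vertex.\<close>

lemma not_coskeletal_2:
  assumes "infinite (UNIV :: 'a set)" "2 \<le> n" "n \<le> 3"
  shows "\<not> skeletal_imp_coskeletal TYPE('a) (Fin 2) (Fin n)"
proof -
  let ?A = "{0, 1, 2, 3, 4} :: nat set"
  let ?G = "{{0, 2, 3}, {1, 3, 4}, {2, 4, 0}, {3, 0, 1}, {4, 1, 2}} :: nat set set"
  show ?thesis
  proof (rule not_skeletal_imp_coskeletal[OF assms(1,2), where A = ?A and G = ?G])
    fix a :: nat assume "a \<in> ?A"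
    then consider "a = 0" | "a = 1" | "a = 2" | "a = 3" | "a = 4" by auto
    \<comment> \<open>\<open>p\<close> and \<open>q\<close> are the neighbours of the deleted
      vertex, \<open>r\<close> and \<open>s\<close> the ends of the opposite side.\<close>
    then obtain p q r s where *: "p \<noteq> q" "p \<noteq> r" "p \<noteq> s" "q \<noteq> r" "q \<noteq> s" "?A - {a} = {p, q} \<union> {r, s}"
      "{T \<in> ?G. a \<notin> T} = (\<lambda>d. insert d {p, q}) ` {r, s}"
    proof cases
      case 1
      show thesis by (rule that[of 1 4 2 3]) (use 1 in auto)
    next
      case 2
      show thesis by (rule that[of 2 0 3 4]) (use 2 in auto)
    next
      case 3
      show thesis by (rule that[of 3 1 4 0]) (use 3 in auto)
    next
      case 4
      show thesis by (rule that[of 4 2 0 1]) (use 4 in auto)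
    next
      case 5
      show thesis by (rule that[of 0 3 1 2]) (use 5 in auto)
    qed
    have "(\<lambda>d. insert d {p, q}) ` {r, s} \<in> hyp 2 ({p, q} \<union> {r, s})" by (rule star_in_hyp) (use * in auto)
    then show "{T \<in> ?G. a \<notin> T} \<in> hyp 2 (?A - {a})" unfolding *(6,7) .
  next
    show "?G \<notin> hyp 2 ?A"
      by (rule not_in_hyp[where T = "{1, 3, 4}" and d = 3 and d' = 4 and R = "{0, 2}"]) auto
  next
    show "n + 2 \<le> card ?A" using assms(3) by simp
  qed auto
qed

lemma not_coskeletal_ge_3:
  assumes inf: "infinite (UNIV :: 'a set)" and l: "3 \<le> l" "l \<le> n" "n + 2 \<le> 2 * l"
  shows "\<not> skeletal_imp_coskeletal TYPE('a) (Fin l) (Fin n)"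
proof -
  let ?S = "{..<l}"
  let ?D = "{l..<2 * l}"
  let ?G = "(\<lambda>d. insert d ?S) ` ?D \<union> (\<lambda>s. insert s ?D) ` ?S"
  have A: "?S \<union> ?D = {..<2 * l}" by auto
  show ?thesis
  proof (rule not_skeletal_imp_coskeletal[OF inf l(2), where A = "?S \<union> ?D" and G = ?G])
    fix a assume "a \<in> ?S \<union> ?D"
    then consider "a \<in> ?S" | "a \<in> ?D" by blast
    then show "{T \<in> ?G. a \<notin> T} \<in> hyp l (?S \<union> ?D - {a})"
    proof cases
      case 1
      have "(\<lambda>s. insert s ?D) ` (?S - {a}) \<in> hyp l (?D \<union> (?S - {a}))"
        by (rule star_in_hyp) auto
      moreover have "?D \<union> (?S - {a}) = ?S \<union> ?D - {a}" using 1 by auto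
      moreover have "(\<lambda>s. insert s ?D) ` (?S - {a}) = {T \<in> ?G. a \<notin> T}" using 1 by auto
      ultimately show ?thesis by simp
    next
      case 2
      have "(\<lambda>d. insert d ?S) ` (?D - {a}) \<in> hyp l (?S \<union> (?D - {a}))"
        by (rule star_in_hyp) auto
      moreover have "?S \<union> (?D - {a}) = ?S \<union> ?D - {a}" using 2 by auto
      moreover have "(\<lambda>d. insert d ?S) ` (?D - {a}) = {T \<in> ?G. a \<notin> T}" using 2 by auto
      ultimately show ?thesis by simp
    qed
  next
    \<comment> \<open>\<open>l\<close> and \<open>l + 1\<close> both complete the half
      \<open>?S\<close>, and both lie on the edge formed by \<open>0\<close> and the other
      half.\<close>
    show "?G \<notin> hyp l (?S \<union> ?D)"
      by (rule not_in_hyp[where T = "insert 0 ?D" and d = l and d' = "l + 1" and R = ?S]) (use l in auto)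
  next
    show "n + 2 \<le> card (?S \<union> ?D)" unfolding A using l by simp
  qed auto
qed

text \<open>The empty presheaf is skeletal here, while its coskeleton, extended from the empty
  category, is terminal and thus not empty.\<close>

lemma not_coskeletal_Minf: "\<not> skeletal_imp_coskeletal TYPE('a) Minf Minf"
proof
  assume imp: "skeletal_imp_coskeletal TYPE('a) Minf Minf"
  define E :: "'a psh" where "E = \<lparr>el = (\<lambda>_. {}), act = (\<lambda>_ _ _ x. x)\<rparr>"
  have elE: "el E A = {}" for A by (simp add: E_def)
  have sym: "symmetric_set E" by (simp add: presheaf_def elE)
  then interpret symset E by unfold_locales
  have "el (sk Minf E) A = {}" for A
    unfolding sk_def by (auto elim!: el_LanE simp: F_obs_def)
  then have "skeletal Minf E" unfolding skeletal_iff_bij by (simp add: elE bij_betw_def)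
  then have "coskeletal Minf E" using imp sym unfolding skeletal_imp_coskeletal_def by blast
  then have "bij_betw (cosk_unit Minf E {0}) (el E {0}) (el (cosk Minf E) {0})"
    unfolding coskeletal_iff_bij by (simp add: F_obs_Pinf_iff)
  then have "el (cosk Minf E) {0} = {}" by (simp add: elE bij_betw_def)
  \<comment> \<open>Over the empty set of objects this default value is the only extensional
    function.\<close>
  moreover have "(\<lambda>_. undefined) \<in> el (cosk Minf E) {0}"
    by (simp add: cosk_def Ran_def F_obs_def)
  ultimately show False by simp
qed

section \<open>The Aufhebung of each level\<close>

lemma skeletal_imp_coskeletal_Fin:
  assumes "l \<le> n" "l + 1 \<le> n" "2 * l \<le> n \<or> 3 \<le> l \<and> n = 2 * l - 1"
  shows "skeletal_imp_coskeletal TYPE('a) (Fin l) (Fin n)"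
  unfolding skeletal_imp_coskeletal_def
proof (intro allI impI)
  fix M :: "'a psh" assume M: "symmetric_set M" "skeletal (Fin l) M"
  interpret symset M by unfold_locales (rule M)
  show "coskeletal (Fin n) M"
    \<comment> \<open>Spheres over at least \<open>n + 2\<close> points are to be filled.
      \<open>l + 1 \<le> n\<close> provides the required \<open>l + 3\<close> points; for
      \<open>n = 2 * l - 1\<close> the sizes start at \<open>2 * l + 1\<close>, the exceptional case
      with \<open>3 \<le> l\<close>.\<close>
    by (rule coskeletal_if_fillers[OF M(2) assms(1)], rule sphere_has_filler[OF M(2)])
      (use assms in auto)
qed

theorem theorem3p7p1:
  fixes l :: "nat extended"
  assumes "infinite (UNIV :: 'a set)"
  shows "is_Aufhebung TYPE('a) l
    (case l of
       Minf \<Rightarrow> Fin 0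
     | Fin n \<Rightarrow>
         (if n = 0 then Fin 1
          else if n = 1 then Fin 2
          else if n = 2 then Fin 4
          else Fin (2 * n - 1))
     | Pinf \<Rightarrow> Pinf)"
proof (cases l)
  case (Fin n)
  define a where "a = (if n = 0 then 1 else if n = 1 then 2 else if n = 2 then 4 else 2 * n - 1)"
  have "skeletal_imp_coskeletal TYPE('a) (Fin n) (Fin a)"
    by (rule skeletal_imp_coskeletal_Fin) (auto simp: a_def)
  moreover have "Fin a \<le> b" if b: "Fin n \<le> b" "skeletal_imp_coskeletal TYPE('a) (Fin n) b" for b
  proof (cases b)
    case (Fin m)
    have "a \<le> m"
    proof (rule ccontr)
      assume "\<not> a \<le> m"
      then have m: "n \<le> m" "m < a" using b(1) Fin by auto
      \<comment> \<open>The candidates \<open>m\<close> are \<open>n\<close> alone for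
        \<open>n \<le> 1\<close>, then \<open>2\<close> and \<open>3\<close> for
        \<open>n = 2\<close>, and those from \<open>n\<close> to \<open>2 * n - 2\<close>
        beyond.\<close>
      consider "n = 0" | "n = 1" | "n = 2" | "3 \<le> n" by linarith
      then have "\<not> skeletal_imp_coskeletal TYPE('a) (Fin n) (Fin m)"
      proof cases
        case 1
        then have "m = 0" using m by (simp add: a_def)
        then show ?thesis using not_coskeletal_0[OF assms] 1 by simp
      next
        case 2
        then have "m = 1" using m by (simp add: a_def)
        then show ?thesis using not_coskeletal_1[OF assms] 2 by simp
      next
        case 3
        then show ?thesis using not_coskeletal_2[OF assms, of m] m by (simp add: a_def)
      next
        case 4
        then show ?thesis using not_coskeletal_ge_3[OF assms 4 m(1)] m by (simp add: a_def)
      qed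
      then show False using b(2) Fin by simp
    qed
    then show ?thesis using Fin by simp
  qed (use b in auto)
  moreover have "n \<le> a" by (auto simp: a_def)
  ultimately have "is_Aufhebung TYPE('a) (Fin n) (Fin a)" by (simp add: is_Aufhebung_def)
  moreover have "Fin a = (if n = 0 then Fin 1 else if n = 1 then Fin 2 else if n = 2 then Fin 4
      else Fin (2 * n - 1))"
    by (simp add: a_def)
  ultimately show ?thesis by (simp only: Fin extended.case)
next
  case Pinf
  have "skeletal_imp_coskeletal TYPE('a) Pinf Pinf"
    unfolding skeletal_imp_coskeletal_def by (simp add: symset.coskeletal_Pinf symset.intro)
  then show ?thesis using Pinf by (simp add: is_Aufhebung_def)
next
  case Minf
  have "skeletal_imp_coskeletal TYPE('a) Minf (Fin 0)"
    unfolding skeletal_imp_coskeletal_def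
    by (meson symset.coskeletal_if_empty symset.intro symset.skeletal_Minf_empty)
  moreover have "Fin 0 \<le> b" if "skeletal_imp_coskeletal TYPE('a) Minf b" for b
    using that not_coskeletal_Minf by (cases b) auto
  ultimately show ?thesis using Minf by (simp add: is_Aufhebung_def)
qed

thm_deps theorem3p7p1

end
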